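(* Let $\lambda=(\lambda_1, \ldots, \lambda_k)$ be a partition (with $k=\ell(\lambda)$ positive parts), $n$ an integer such that $n-i \geq \lambda_i$ for all $i \in [k]$, and $\mathbf{a} \in \mathbb{Z}_{>0}^n$. Then the face poset of the flow polytope $\mathcal{F}_{G(\lambda,n)}(\mathbf{a})$ is isomorphic to the face poset of the Cartesian product of simplices $\Delta_{\lambda_1} \times \Delta_{\lambda_2} \times \cdots \times \Delta_{\lambda_k}$. In particular, the $h$-polynomial of $\mathcal{F}_{G(\lambda,n)}(\mathbf{a})$ is $$\sum_{i = 0}^{\lambda_1+\cdots+\lambda_k} h_i x^i = \prod_{i=1}^k \left(\sum_{j=0}^{\lambda_i} x^j\right).$$
   Context: A partition $\lambda$ is a weakly decreasing finite sequence of positive integers; $\ell(\lambda)$ is its number of parts; $[m]=\{1,\dots,m\}$. Flow polytope: for a graph $G$ on vertex set $[n+1]$ with each edge written $(i,j)$, $i<j$ (directed from $i$ to $j$), and $\mathbf{a}=(a_1,\ldots,a_n)\in\mathbb{Z}^n$, set $a_{n+1}:=-\sum_{i=1}^n a_i$. An $\mathbf{a}$-flow on $G$ is a function $f:E(G)\to\mathbb{R}_{\ge 0}$ with $\sum_{(g,i)\in E(G)} f(g,i)+a_i=\sum_{(i,j)\in E(G)} f(i,j)$ for all $1\le i\le n+1$. The flow polytope $\mathcal{F}_G(\mathbf{a})\subset\mathbb{R}^{E(G)}$ is the set of all $\mathbf{a}$-flows on $G$. The graph $G(\lambda,n)$: for an integer $n$ with $n-i\ge\lambda_i$ for all $i\in[\ell(\lambda)]$,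 $G(\lambda,n)$ is the graph on $[n+1]$ with edge set $\{(i,n+1): i\in[n]\}\cup\{(i,j): i\in[\ell(\lambda)],\ n+1-\lambda_i\le j\le n\}$. $\Delta_d$ is the standard $d$-dimensional simplex. The face poset is the set of faces ordered by inclusion. The $h$-polynomial of a $d$-dimensional simple polytope with $f_i$ faces of dimension $i$ is $\sum_{i=0}^d h_i x^i:=\sum_{i=0}^d f_i (x-1)^i$. *)

theory Defs
  imports
    "HOL-Analysis.Analysis"
    "HOL-Analysis.Finite_Function_Topology"
    "HOL-Homology.Simplices"
    "HOL-Computational_Algebra.Polynomial"
begin

text \<open>
  For a finite index set \<open>I\<close> whose size is not fixed in advance, \<open>\<real>\<^sup>I\<close> is the coordinate subspace of
  the real vector space of finitely supported functions with \<open>Poly_Mapping.keys x \<subseteq> I\<close>.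
\<close>

subsection \<open>Faces and the h-polynomial\<close>

definition faces :: "'a::real_vector set \<Rightarrow> 'a set set" where
  "faces P = {F. F face_of P}"

definition face_poset_isomorphic :: "'a::real_vector set \<Rightarrow> 'b::real_vector set \<Rightarrow> bool" where
  "face_poset_isomorphic P Q \<longleftrightarrow>
     (\<exists>\<phi>. bij_betw \<phi> (faces P) (faces Q) \<and>
          (\<forall>F\<in>faces P. \<forall>G\<in>faces P. F \<subseteq> G \<longleftrightarrow> \<phi> F \<subseteq> \<phi> G))"

text \<open>
  Dimension of the direction space of the affine hull. The library's \<^const>\<open>aff_dim\<close> is only
  available in Euclidean spaces, where it agrees with this on nonempty sets; here the empty set has
  dimension 0 and must be excluded by hand.
\<close>

definition direction_dim :: "'a::real_vector set \<Rightarrow> nat" where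
  "direction_dim S = dim {x - y | x y. x \<in> S \<and> y \<in> S}"

lemma aff_dim_eq_direction_dim:
  fixes S :: "'a::euclidean_space set"
  assumes "S \<noteq> {}"
  shows "aff_dim S = int (direction_dim S)"
proof -
  obtain a where a: "a \<in> S" using assms by auto
  define T where "T = (\<lambda>x. - a + x) ` S"
  define D where "D = {x - y | x y. x \<in> S \<and> y \<in> S}"
  have "T \<subseteq> D" using a by (force simp: T_def D_def)
  then have 1: "span T \<subseteq> span D" by (rule span_mono)
  have "D \<subseteq> span T"
  proof
    fix z assume "z \<in> D"
    then obtain x y where z: "z = x - y" "x \<in> S" "y \<in> S" by (auto simp: D_def)
    have "(- a + x) - (- a + y) \<in> span T"
      using z by (intro span_diff span_base) (auto simp: T_def)
    then show "z \<in> span T" by (simp add: z)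
  qed
  then have "span D \<subseteq> span T" by (rule span_minimal) (rule subspace_span)
  with 1 have "span D = span T" by (rule subset_antisym[rotated])
  then have "dim (span D) = dim (span T)" by (rule arg_cong)
  then have "dim T = dim D" by (simp only: dim_span)
  moreover have "aff_dim S = int (dim T)"
    unfolding T_def by (rule aff_dim_eq_dim) (simp add: a hull_inc)
  ultimately show ?thesis
    by (simp only: direction_dim_def D_def)
qed

definition f_number :: "'a::real_vector set \<Rightarrow> nat \<Rightarrow> nat" where
  "f_number P i = card {F \<in> faces P. F \<noteq> {} \<and> direction_dim F = i}"

definition simple_polytope :: "'a::real_vector set \<Rightarrow> bool" where
  "simple_polytope P \<longleftrightarrow>
     polytope P \<and>
     (\<forall>v. v extreme_point_of P \<longrightarrow>
        card {F \<in> faces P. v \<in> F \<and> direction_dim F = 1} = direction_dim P)"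

definition h_polynomial :: "'a::real_vector set \<Rightarrow> int poly" where
  "h_polynomial P =
     (\<Sum>i = 0..direction_dim P. of_nat (f_number P i) * ([:0, 1:] - 1) ^ i)"

subsection \<open>Partitions and products of simplices\<close>

definition is_partition :: "nat list \<Rightarrow> bool" where
  "is_partition lam \<longleftrightarrow> sorted_wrt (\<ge>) lam \<and> (\<forall>p\<in>set lam. 0 < p)"

text \<open>Parts are numbered from 1.\<close>

definition ith_part :: "nat list \<Rightarrow> nat \<Rightarrow> nat" where
  "ith_part lam i = lam ! (i - 1)"

text \<open>The \<open>i\<close>-th factor lives in the coordinates \<open>(i, 0), \<dots>, (i, ith_part lam i)\<close>.\<close>

definition simplex_product :: "nat list \<Rightarrow> ((nat \<times> nat) \<Rightarrow>\<^sub>0 real) set" where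
  "simplex_product lam =
     {x. (\<forall>i\<in>{1..length lam}.
            (\<lambda>j. Poly_Mapping.lookup x (i, j)) \<in> standard_simplex (ith_part lam i)) \<and>
         (\<forall>i j. i \<notin> {1..length lam} \<longrightarrow> Poly_Mapping.lookup x (i, j) = 0)}"

subsection \<open>Flow polytopes\<close>

text \<open>A graph on \<open>{1..n + 1}\<close> is given by its finite set of edges \<open>(i, j)\<close> with \<open>i < j\<close>.\<close>

definition netflow :: "nat \<Rightarrow> (nat \<Rightarrow> int) \<Rightarrow> nat \<Rightarrow> int" where
  "netflow n a i = (if i = n + 1 then - (\<Sum>j = 1..n. a j) else a i)"

definition flow_polytope ::
    "nat \<Rightarrow> (nat \<times> nat) set \<Rightarrow> (nat \<Rightarrow> int) \<Rightarrow> ((nat \<times> nat) \<Rightarrow>\<^sub>0 real) set" where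
  "flow_polytope n E a =
     {f. Poly_Mapping.keys f \<subseteq> E \<and>
         (\<forall>e\<in>E. 0 \<le> Poly_Mapping.lookup f e) \<and>
         (\<forall>i\<in>{1..n + 1}.
            (\<Sum>g | (g, i) \<in> E. Poly_Mapping.lookup f (g, i)) + of_int (netflow n a i)
            = (\<Sum>j | (i, j) \<in> E. Poly_Mapping.lookup f (i, j)))}"

definition partition_graph :: "nat list \<Rightarrow> nat \<Rightarrow> (nat \<times> nat) set" where
  "partition_graph lam n =
     {(i, n + 1) | i. i \<in> {1..n}} \<union>
     {(i, j) | i j. i \<in> {1..length lam} \<and> n + 1 - ith_part lam i \<le> j \<and> j \<le> n}"

end

theory Submission
  imports Defs
begin

text \<open>
  A polyhedron cut out of the nonnegative orthant by affine equations has one nonempty face for each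
  support of one of its points, ordered by inclusion of supports. All netflows are positive, so every
  node except the last has positive throughput; hence the supports of flows are exactly the edge
  sets containing an outgoing edge at each of the nodes \<open>1, \<dots>, n\<close>, since the throughput of each node
  can be distributed freely along its outgoing edges. Choosing a nonempty set of outgoing edges at
  each node is choosing a nonempty face of a product of simplices. The face with support \<open>S\<close> has
  dimension \<open>card S - n\<close>, and the generating function of the supports factors over the nodes.
\<close>

subsection \<open>Faces of polyhedra in standard form\<close>

text \<open>The ambient space of finitely supported functions has infinite dimension, so faces,
  vertices and dimensions are obtained from the finitely many supports inside \<open>E\<close>
  instead of from compactness: a face is recovered from a point of maximal support in it, and the
  vertices are found as points of minimal support. What remains to be excluded is an unbounded
  direction. The condition for this is that no point of the affine space dominates another
  coordinatewise, which flows satisfy because the graph is acyclic: node by node, equal inflow gives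
  equal outflow. Acyclicity also produces all flows that are needed, by fixing how each node
  distributes what it receives and computing throughputs in the order of the nodes. The
  \<open>n\<close> subtracted in the dimension counts one dependent edge for each node; in the
  linear space of directions the values on the other edges of a support are free.\<close>

lemma lookup_scaleR [simp]:
  "Poly_Mapping.lookup (c *\<^sub>R x) i = c *\<^sub>R Poly_Mapping.lookup x i"
proof -
  have "finite {i. c *\<^sub>R Poly_Mapping.lookup x i \<noteq> 0}"
    by (rule finite_subset[OF _ finite_keys[of x]]) (auto simp: in_keys_iff)
  then show ?thesis
    by (simp add: scaleR_poly_mapping_def)
qed

text \<open>Nonnegative coordinates cannot cancel. Hence a point inside a segment of the orthant has
  the union of the supports of both ends as its support, which turns convexity into inclusion of
  sets.\<close>

lemma keys_add_nonneg:
  fixes x y :: "'a \<Rightarrow>\<^sub>0 real"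
  assumes "\<And>e. 0 \<le> Poly_Mapping.lookup x e" and "\<And>e. 0 \<le> Poly_Mapping.lookup y e"
  shows "Poly_Mapping.keys (x + y) = Poly_Mapping.keys x \<union> Poly_Mapping.keys y"
  using assms by (auto simp: in_keys_iff lookup_add add_nonneg_eq_0_iff)

lemma keys_scaleR:
  fixes x :: "'a \<Rightarrow>\<^sub>0 real"
  assumes "c \<noteq> 0"
  shows "Poly_Mapping.keys (c *\<^sub>R x) = Poly_Mapping.keys x"
  using assms by (auto simp: in_keys_iff)

lemma keys_scaleR_subset:
  fixes x :: "'a \<Rightarrow>\<^sub>0 real"
  shows "Poly_Mapping.keys (c *\<^sub>R x) \<subseteq> Poly_Mapping.keys x"
  by (auto simp: in_keys_iff)

lemma subspace_keys_subset: "subspace {x :: 'a \<Rightarrow>\<^sub>0 real. Poly_Mapping.keys x \<subseteq> S}"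
proof (rule subspaceI)
  fix x y :: "'a \<Rightarrow>\<^sub>0 real"
  assume "x \<in> {x. Poly_Mapping.keys x \<subseteq> S}" "y \<in> {x. Poly_Mapping.keys x \<subseteq> S}"
  then show "x + y \<in> {x. Poly_Mapping.keys x \<subseteq> S}"
    using Poly_Mapping.keys_add[of x y] by simp blast
next
  fix c and x :: "'a \<Rightarrow>\<^sub>0 real"
  assume "x \<in> {x. Poly_Mapping.keys x \<subseteq> S}"
  then show "c *\<^sub>R x \<in> {x. Poly_Mapping.keys x \<subseteq> S}"
    using keys_scaleR_subset[of c x] by simp
qed simp

text \<open>\<open>S\<close> is arbitrary here, and distinct \<open>S\<close> can give the same
  face; it is the supports of points of \<open>P\<close> that parametrize the nonempty faces without
  repetition.\<close>

definition support_face :: "('a \<Rightarrow>\<^sub>0 real) set \<Rightarrow> 'a set \<Rightarrow> ('a \<Rightarrow>\<^sub>0 real) set" where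
  "support_face P S = {x \<in> P. Poly_Mapping.keys x \<subseteq> S}"

locale standard_form =
  fixes A P :: "('a \<Rightarrow>\<^sub>0 real) set" and E :: "'a set"
  assumes finite_E: "finite E"
    and affine_A: "affine A"
    and keys_A: "x \<in> A \<Longrightarrow> Poly_Mapping.keys x \<subseteq> E"
    and P_eq: "P = {x \<in> A. \<forall>e. 0 \<le> Poly_Mapping.lookup x e}"
begin

lemma P_in_A: "x \<in> P \<Longrightarrow> x \<in> A"
  by (simp add: P_eq)

lemma P_nonneg: "x \<in> P \<Longrightarrow> 0 \<le> Poly_Mapping.lookup x e"
  by (simp add: P_eq)

lemma keys_subset: "x \<in> P \<Longrightarrow> Poly_Mapping.keys x \<subseteq> E"
  by (simp add: P_in_A keys_A)

lemma finite_supports: "finite (Poly_Mapping.keys ` P)"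
  by (rule finite_subset[of _ "Pow E"]) (use keys_subset finite_E in auto)

lemma affine_line:
  assumes "x \<in> A" and "x + d \<in> A"
  shows "x + c *\<^sub>R d \<in> A"
proof -
  have "(1 - c) *\<^sub>R x + c *\<^sub>R (x + d) \<in> A"
    using affine_A assms unfolding affine_alt by blast
  then show ?thesis
    by (simp add: algebra_simps)
qed

lemma convex_P: "convex P"
proof -
  have "convex A"
    using affine_A by (rule affine_imp_convex)
  then show ?thesis
    unfolding convex_def P_eq by (auto simp: lookup_add)
qed

text \<open>The coordinates of \<open>x\<close> in its support are strictly positive and finitely
  many, and \<open>d\<close> changes no others, so a small enough step keeps all of them
  nonnegative.\<close>

lemma perturb:
  assumes x: "x \<in> P" and xd: "x + d \<in> A" and d: "Poly_Mapping.keys d \<subseteq> Poly_Mapping.keys x"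
  obtains \<epsilon> where "\<epsilon> > 0" and "x + \<epsilon> *\<^sub>R d \<in> P"
proof -
  \<comment> \<open>Adding 1 keeps the denominator positive where \<open>d\<close> vanishes; the 1
    inserted into the minimum below covers an empty support.\<close>
  define r where "r = (\<lambda>e. Poly_Mapping.lookup x e / (\<bar>Poly_Mapping.lookup d e\<bar> + 1))"
  define \<epsilon> where "\<epsilon> = Min (insert 1 (r ` Poly_Mapping.keys x))"
  have r: "r e > 0" if "e \<in> Poly_Mapping.keys x" for e
    using that P_nonneg[OF x, of e] by (auto simp: r_def in_keys_iff intro!: divide_pos_pos)
  have pos: "\<epsilon> > 0"
    unfolding \<epsilon>_def by (subst Min_gr_iff) (auto intro: r)
  have "0 \<le> Poly_Mapping.lookup (x + \<epsilon> *\<^sub>R d) e" for e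
  proof (cases "e \<in> Poly_Mapping.keys x")
    case True
    then have "\<epsilon> \<le> r e"
      unfolding \<epsilon>_def by (intro Min_le) auto
    then have "\<epsilon> * (\<bar>Poly_Mapping.lookup d e\<bar> + 1) \<le> Poly_Mapping.lookup x e"
      by (simp add: r_def pos_le_divide_eq)
    moreover have "- (\<epsilon> * Poly_Mapping.lookup d e) \<le> \<epsilon> * \<bar>Poly_Mapping.lookup d e\<bar>"
      using pos by (metis abs_ge_minus_self abs_mult abs_of_pos)
    ultimately show ?thesis
      using pos by (simp add: lookup_add algebra_simps)
  next
    case False
    then have "Poly_Mapping.lookup d e = 0" "Poly_Mapping.lookup x e = 0"
      using d by (auto simp: in_keys_iff)
    then show ?thesis by (simp add: lookup_add)
  qed
  moreover have "x + \<epsilon> *\<^sub>R d \<in> A"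
    using P_in_A[OF x] xd by (rule affine_line)
  ultimately have "x + \<epsilon> *\<^sub>R d \<in> P"
    by (simp add: P_eq)
  with pos show thesis by (rule that)
qed

lemma support_face_self: "x \<in> P \<Longrightarrow> x \<in> support_face P (Poly_Mapping.keys x)"
  by (simp add: support_face_def)

lemma support_face_subset_iff:
  assumes "x \<in> P" and "y \<in> P"
  shows "support_face P (Poly_Mapping.keys x) \<subseteq> support_face P (Poly_Mapping.keys y)
     \<longleftrightarrow> Poly_Mapping.keys x \<subseteq> Poly_Mapping.keys y"
  using assms by (auto simp: support_face_def)

text \<open>A point inside a segment of \<open>P\<close> carries the supports of both ends, so it
  can only be supported in \<open>S\<close> if both ends are.\<close>

lemma support_face_face_of: "support_face P S face_of P"
proof -
  have eq: "Poly_Mapping.keys ((1 - u) *\<^sub>R a + u *\<^sub>R b)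
      = Poly_Mapping.keys a \<union> Poly_Mapping.keys b"
    if "a \<in> P" "b \<in> P" "0 < u" "u < 1" for a b u
    using that by (subst keys_add_nonneg) (auto simp: keys_scaleR P_nonneg)
  have "support_face P S = P \<inter> {x. Poly_Mapping.keys x \<subseteq> S}"
    by (auto simp: support_face_def)
  moreover have "convex {x :: 'a \<Rightarrow>\<^sub>0 real. Poly_Mapping.keys x \<subseteq> S}"
    by (intro subspace_imp_convex subspace_keys_subset)
  ultimately have "convex (support_face P S)"
    by (simp add: convex_P convex_Int)
  then show ?thesis
    unfolding face_of_def by (auto simp: support_face_def in_segment eq)
qed

text \<open>Averaging with a point \<open>x\<close> of maximal support in \<open>F\<close> shows
  that all supports in \<open>F\<close> lie in that of \<open>x\<close>. Conversely, if the support
  of \<open>y\<close> is contained in that of \<open>x\<close>, the segment from \<open>y\<close> to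
  \<open>x\<close> can be prolonged slightly beyond \<open>x\<close> within \<open>P\<close>; then
  \<open>x\<close> is interior to it and the face property puts \<open>y\<close> into
  \<open>F\<close>.\<close>

lemma face_of_imp_support_face:
  assumes F: "F face_of P" and ne: "F \<noteq> {}"
  shows "\<exists>x\<in>P. F = support_face P (Poly_Mapping.keys x)"
proof -
  have FP: "F \<subseteq> P" and cF: "convex F"
    using F by (auto simp: face_of_def)
  obtain x0 where "x0 \<in> F" using ne by auto
  moreover have "card (Poly_Mapping.keys y) \<le> card E" if "y \<in> F" for y
    using that FP keys_subset by (intro card_mono finite_E) auto
  ultimately obtain x where x: "x \<in> F"
    and mx: "\<And>y. y \<in> F \<Longrightarrow> card (Poly_Mapping.keys y) \<le> card (Poly_Mapping.keys x)"
    using ex_has_greatest_nat[of "\<lambda>y. y \<in> F" x0 "\<lambda>y. card (Poly_Mapping.keys y)" "Suc (card E)"]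
    by (auto simp: less_Suc_eq_le)
  have xP: "x \<in> P" using x FP by auto
  have "Poly_Mapping.keys y \<subseteq> Poly_Mapping.keys x" if y: "y \<in> F" for y
  proof -
    let ?m = "(1/2) *\<^sub>R x + (1/2) *\<^sub>R y"
    have "?m \<in> F"
      using cF x y unfolding convex_def by (metis add_nonneg_pos field_sum_of_halves half_gt_zero_iff less_eq_real_def zero_less_one)
    then have "card (Poly_Mapping.keys ?m) \<le> card (Poly_Mapping.keys x)"
      by (rule mx)
    moreover have "Poly_Mapping.keys ?m = Poly_Mapping.keys x \<union> Poly_Mapping.keys y"
      using x y FP by (subst keys_add_nonneg) (auto simp: keys_scaleR intro!: P_nonneg)
    ultimately have "Poly_Mapping.keys x = Poly_Mapping.keys x \<union> Poly_Mapping.keys y"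
      by (intro card_seteq) auto
    then show ?thesis by blast
  qed
  moreover have "y \<in> F" if y: "y \<in> P" and ky: "Poly_Mapping.keys y \<subseteq> Poly_Mapping.keys x" for y
  proof (cases "y = x")
    case True
    then show ?thesis using x by simp
  next
    case False
    \<comment> \<open>The reflection of \<open>y\<close> in \<open>x\<close> lies in
      \<open>A\<close>, which makes \<open>x - y\<close> an admissible direction for
      \<open>perturb\<close>.\<close>
    have "x + (- 1) *\<^sub>R (y - x) \<in> A"
      using P_in_A[OF xP] P_in_A[OF y] by (intro affine_line) simp_all
    moreover have "Poly_Mapping.keys (x - y) \<subseteq> Poly_Mapping.keys x"
      using ky by (auto simp: in_keys_iff lookup_minus subset_iff)
    ultimately obtain \<epsilon> where e: "\<epsilon> > 0" and z: "x + \<epsilon> *\<^sub>R (x - y) \<in> P"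
      using perturb[OF xP, of "x - y"] by (auto simp: algebra_simps)
    let ?z = "x + \<epsilon> *\<^sub>R (x - y)"
    \<comment> \<open>The weight \<open>w\<close> solves \<open>w * (1 + \<epsilon>) = 1\<close>,
      the total coefficient of \<open>x\<close> on the right-hand side; the terms in
      \<open>y\<close> then cancel.\<close>
    have xz: "x = (1 - 1 / (1 + \<epsilon>)) *\<^sub>R y + (1 / (1 + \<epsilon>)) *\<^sub>R ?z"
    proof (rule poly_mapping_eqI)
      fix k
      show "Poly_Mapping.lookup x k = Poly_Mapping.lookup ((1 - 1 / (1 + \<epsilon>)) *\<^sub>R y + (1 / (1 + \<epsilon>)) *\<^sub>R ?z) k"
        using e by (simp add: lookup_add lookup_minus divide_simps) (simp add: algebra_simps)
    qed
    have "y \<noteq> ?z"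
    proof
      assume eq: "y = ?z"
      have "(1 + \<epsilon>) *\<^sub>R (x - y) = ?z - y"
        by (simp add: algebra_simps)
      with eq have "(1 + \<epsilon>) *\<^sub>R (x - y) = 0" by simp
      with e False show False by auto
    qed
    then have "x \<in> open_segment y ?z"
      unfolding in_segment using xz e by (intro conjI exI[of _ "1 / (1 + \<epsilon>)"]) auto
    then show ?thesis
      using F x y z unfolding face_of_def by blast
  qed
  ultimately have "F = support_face P (Poly_Mapping.keys x)"
    using FP by (auto simp: support_face_def)
  with xP show ?thesis by blast
qed

lemma faces_eq: "faces P = insert {} (support_face P ` Poly_Mapping.keys ` P)"
  using face_of_imp_support_face support_face_face_of by (auto simp: faces_def)

text \<open>This inverse of \<open>support_face\<close> yields injectivity, and it is how faces are
  carried from one polyhedron to another.\<close>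

lemma Union_keys_support_face:
  "x \<in> P \<Longrightarrow> \<Union> (Poly_Mapping.keys ` support_face P (Poly_Mapping.keys x)) = Poly_Mapping.keys x"
  by (auto simp: support_face_def)

lemma support_face_inj_on: "inj_on (support_face P) (Poly_Mapping.keys ` P)"
  by (rule inj_on_inverseI[where g = "\<lambda>F. \<Union> (Poly_Mapping.keys ` F)"])
    (use Union_keys_support_face in auto)

text \<open>The direction space of a face becomes a space given by linear conditions, whose
  dimension can be computed. By \<open>perturb\<close>, each direction satisfying them is a multiple
  of a difference of two points of the face, one of them \<open>x\<close>.\<close>

lemma span_differences_support_face:
  assumes x: "x \<in> P"
  shows "span {u - v | u v. u \<in> support_face P (Poly_Mapping.keys x)
                          \<and> v \<in> support_face P (Poly_Mapping.keys x)}
       = {d. Poly_Mapping.keys d \<subseteq> Poly_Mapping.keys x \<and> x + d \<in> A}" (is "span ?D = ?L")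
proof
  have sub: "subspace ?L"
    unfolding subspace_def
  proof (intro conjI ballI allI)
    show "0 \<in> ?L" using P_in_A[OF x] by simp
  next
    fix d e assume "d \<in> ?L" "e \<in> ?L"
    then have d: "x + d \<in> A" and e: "x + e \<in> A"
      and k: "Poly_Mapping.keys d \<subseteq> Poly_Mapping.keys x" "Poly_Mapping.keys e \<subseteq> Poly_Mapping.keys x"
      by auto
    \<comment> \<open>The midpoint of \<open>x + d\<close> and \<open>x + e\<close> is
      \<open>x + (1/2) *\<^sub>R (d + e)\<close>; doubling the displacement from \<open>x\<close>
      stays on a line of \<open>A\<close>.\<close>
    have "(x + d) + (1/2) *\<^sub>R (e - d) \<in> A"
      using d e by (intro affine_line) simp_all
    also have "(x + d) + (1/2) *\<^sub>R (e - d) = x + (1/2) *\<^sub>R (d + e)"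
      by (rule poly_mapping_eqI) (simp add: lookup_add lookup_minus field_simps)
    finally have "x + (1/2) *\<^sub>R (d + e) \<in> A" .
    then have "x + 2 *\<^sub>R (1/2) *\<^sub>R (d + e) \<in> A"
      by (rule affine_line[OF P_in_A[OF x]])
    then show "d + e \<in> ?L"
      using k Poly_Mapping.keys_add[of d e] by auto
  next
    fix c d assume "d \<in> ?L"
    then show "c *\<^sub>R d \<in> ?L"
      using P_in_A[OF x] affine_line[of x d c] keys_scaleR_subset[of c d] by auto
  qed
  have "?D \<subseteq> ?L"
  proof clarify
    fix u v assume u: "u \<in> support_face P (Poly_Mapping.keys x)"
      and v: "v \<in> support_face P (Poly_Mapping.keys x)"
    have *: "u - x \<in> ?L" if "u \<in> support_face P (Poly_Mapping.keys x)" for u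
      using that P_in_A by (auto simp: support_face_def in_keys_iff lookup_minus subset_iff)
    have "(u - x) - (v - x) \<in> ?L"
      using sub *[OF u] *[OF v] by (rule subspace_diff)
    then show "Poly_Mapping.keys (u - v) \<subseteq> Poly_Mapping.keys x \<and> x + (u - v) \<in> A"
      by simp
  qed
  then show "span ?D \<subseteq> ?L"
    using sub by (rule span_minimal)
  show "?L \<subseteq> span ?D"
  proof clarify
    fix d assume k: "Poly_Mapping.keys d \<subseteq> Poly_Mapping.keys x" and "x + d \<in> A"
    then obtain \<epsilon> where e: "\<epsilon> > 0" and z: "x + \<epsilon> *\<^sub>R d \<in> P"
      using perturb[OF x] by metis
    have "Poly_Mapping.keys (x + \<epsilon> *\<^sub>R d) \<subseteq> Poly_Mapping.keys x"
      using k Poly_Mapping.keys_add[of x "\<epsilon> *\<^sub>R d"] keys_scaleR[of \<epsilon> d] e by auto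
    with z have "x + \<epsilon> *\<^sub>R d \<in> support_face P (Poly_Mapping.keys x)"
      by (simp add: support_face_def)
    with support_face_self[OF x] have "(x + \<epsilon> *\<^sub>R d) - x \<in> ?D"
      by blast
    then have "(1 / \<epsilon>) *\<^sub>R ((x + \<epsilon> *\<^sub>R d) - x) \<in> span ?D"
      by (intro span_scale span_base)
    then show "d \<in> span ?D"
      using e by simp
  qed
qed

text \<open>A point \<open>x\<close> outside \<open>V\<close> admits another point \<open>y\<close>
  of \<open>P\<close> supported within its support. Walking from \<open>x\<close> along
  \<open>x - y\<close> and along \<open>y - x\<close> until a further coordinate vanishes gives two
  points of smaller support with \<open>x\<close> between them, and induction on the size of the
  support ends in \<open>V\<close>. The hypothesis stops both walks: a direction without negative
  coordinates would lead to a point dominating \<open>x\<close>.\<close>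

lemma polytope_P:
  assumes pointed: "\<And>x y. x \<in> A \<Longrightarrow> y \<in> A \<Longrightarrow>
    (\<And>e. Poly_Mapping.lookup x e \<le> Poly_Mapping.lookup y e) \<Longrightarrow> x = y"
  shows "polytope P"
proof -
  have shrink: "\<exists>s>0. x + s *\<^sub>R d \<in> P \<and> Poly_Mapping.keys (x + s *\<^sub>R d) \<subset> Poly_Mapping.keys x"
    if x: "x \<in> P" and xd: "x + d \<in> A" and "d \<noteq> 0"
      and k: "Poly_Mapping.keys d \<subseteq> Poly_Mapping.keys x" for x d
  proof -
    define N where "N = {e. Poly_Mapping.lookup d e < 0}"
    define r where "r = (\<lambda>e. Poly_Mapping.lookup x e / - Poly_Mapping.lookup d e)"
    \<comment> \<open>The ratio test: the longest step along \<open>d\<close> that keeps all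
      decreasing coordinates nonnegative. A coordinate attaining the minimum drops to zero.\<close>
    define s where "s = Min (r ` N)"
    have Nk: "N \<subseteq> Poly_Mapping.keys x"
      using k by (auto simp: N_def in_keys_iff)
    then have fin: "finite N"
      by (rule finite_subset) simp
    have "N \<noteq> {}"
    proof
      assume "N = {}"
      then have "x = x + d"
        using P_in_A[OF x] xd by (intro pointed) (auto simp: N_def lookup_add not_less)
      with \<open>d \<noteq> 0\<close> show False by simp
    qed
    then have "s \<in> r ` N"
      unfolding s_def using fin by (intro Min_in) auto
    then obtain e where e: "e \<in> N" "s = r e" by auto
    have pos: "Poly_Mapping.lookup x e > 0"
      using e Nk P_nonneg[OF x, of e] by (auto simp: in_keys_iff less_le)
    then have s: "s > 0"
      using e by (simp add: r_def N_def divide_pos_neg)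
    have z: "Poly_Mapping.lookup (x + s *\<^sub>R d) e = 0"
      using e by (simp add: r_def N_def lookup_add lookup_minus)
    have "0 \<le> Poly_Mapping.lookup (x + s *\<^sub>R d) i" for i
    proof (cases "i \<in> N")
      case True
      then have "s \<le> r i" unfolding s_def using fin by (intro Min_le) auto
      then have "s * - Poly_Mapping.lookup d i \<le> Poly_Mapping.lookup x i"
        using True unfolding r_def by (subst (asm) pos_le_divide_eq) (auto simp: N_def)
      then show ?thesis by (simp add: lookup_add)
    next
      case False
      then show ?thesis using s P_nonneg[OF x, of i] by (simp add: N_def lookup_add)
    qed
    then have "x + s *\<^sub>R d \<in> P"
      using affine_line[OF P_in_A[OF x] xd] by (simp add: P_eq)
    moreover have "Poly_Mapping.keys (x + s *\<^sub>R d) \<subseteq> Poly_Mapping.keys x"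
      using k Poly_Mapping.keys_add[of x "s *\<^sub>R d"] keys_scaleR[of s d] s by auto
    moreover have "e \<in> Poly_Mapping.keys x - Poly_Mapping.keys (x + s *\<^sub>R d)"
      using pos z by (simp add: in_keys_iff)
    ultimately show ?thesis using s by blast
  qed
  \<comment> \<open>Such points are determined by their supports, so there is at most one for each
    subset of \<open>E\<close>.\<close>
  define V where "V = {x \<in> P. \<forall>y\<in>P. Poly_Mapping.keys y \<subseteq> Poly_Mapping.keys x \<longrightarrow> y = x}"
  have "inj_on Poly_Mapping.keys V"
    by (rule inj_onI) (auto simp: V_def)
  moreover have "finite (Poly_Mapping.keys ` V)"
    by (rule finite_subset[OF _ finite_supports]) (auto simp: V_def)
  ultimately have "finite V"
    by (rule finite_imageD[rotated])
  moreover have "x \<in> convex hull V" if "x \<in> P" for x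
    using that
  proof (induction "card (Poly_Mapping.keys x)" arbitrary: x rule: less_induct)
    case less
    show ?case
    proof (cases "x \<in> V")
      case True
      then show ?thesis by (rule hull_inc)
    next
      case False
      then obtain y where y: "y \<in> P" "Poly_Mapping.keys y \<subseteq> Poly_Mapping.keys x" "y \<noteq> x"
        using less.prems by (auto simp: V_def)
      have in_hull: "\<exists>s>0. x + s *\<^sub>R d \<in> convex hull V"
        if "x + d \<in> A" "d \<noteq> 0" "Poly_Mapping.keys d \<subseteq> Poly_Mapping.keys x" for d
        using shrink[OF less.prems that] less.hyps by (meson psubset_card_mono finite_keys)
      have "x + (- 1) *\<^sub>R (y - x) \<in> A"
        using P_in_A[OF less.prems] P_in_A[OF y(1)] by (intro affine_line) simp_all
      moreover have "Poly_Mapping.keys (x - y) \<subseteq> Poly_Mapping.keys x"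
          "Poly_Mapping.keys (y - x) \<subseteq> Poly_Mapping.keys x"
        using y by (auto simp: in_keys_iff lookup_minus subset_iff)
      ultimately obtain s t where s: "s > 0" "x + s *\<^sub>R (x - y) \<in> convex hull V"
        and t: "t > 0" "x + t *\<^sub>R (y - x) \<in> convex hull V"
        using in_hull[of "x - y"] in_hull[of "y - x"] P_in_A[OF y(1)] y(3) by auto
      have st: "s + t > 0" using s t by simp
      \<comment> \<open>The weights make the displacements of lengths \<open>s\<close> and
        \<open>t\<close> in opposite directions cancel.\<close>
      have "(t / (s + t)) *\<^sub>R (x + s *\<^sub>R (x - y)) + (s / (s + t)) *\<^sub>R (x + t *\<^sub>R (y - x))
          \<in> convex hull V"
        using s t by (intro convexD convex_convex_hull) (auto simp flip: add_divide_distrib)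
      also have "(t / (s + t)) *\<^sub>R (x + s *\<^sub>R (x - y)) + (s / (s + t)) *\<^sub>R (x + t *\<^sub>R (y - x)) = x"
        by (rule poly_mapping_eqI)
          (use st in \<open>simp add: lookup_add lookup_minus divide_simps, simp add: algebra_simps\<close>)
      finally show ?thesis .
    qed
  qed
  moreover have "convex hull V \<subseteq> P"
    by (rule hull_minimal) (auto simp: V_def convex_P)
  ultimately show ?thesis
    unfolding polytope_def by blast
qed

end

section \<open>Comparing face posets through supports\<close>

text \<open>Supports with their inclusions determine the nonempty faces with theirs, so matching
  supports is enough. Injectivity comes from antisymmetry, as inclusions are reflected.\<close>

lemma face_poset_isomorphicI:
  assumes P: "standard_form A P E" and Q: "standard_form B Q D"
    and image: "\<sigma> ` Poly_Mapping.keys ` P = Poly_Mapping.keys ` Q"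
    and mono: "\<And>S T. S \<in> Poly_Mapping.keys ` P \<Longrightarrow> T \<in> Poly_Mapping.keys ` P \<Longrightarrow>
      \<sigma> S \<subseteq> \<sigma> T \<longleftrightarrow> S \<subseteq> T"
  shows "face_poset_isomorphic P Q"
proof -
  interpret P: standard_form A P E by fact
  interpret Q: standard_form B Q D by fact
  \<comment> \<open>The empty face is mapped separately: its union of supports is the empty set, and
    \<open>support_face Q (\<sigma> {})\<close> need not be empty.\<close>
  define \<phi> where "\<phi> F = (if F = {} then {} else support_face Q (\<sigma> (\<Union> (Poly_Mapping.keys ` F))))"
    for F :: "('a \<Rightarrow>\<^sub>0 real) set"
  have \<phi>: "\<phi> (support_face P S) = support_face Q (\<sigma> S)"
    and neP: "support_face P S \<noteq> {}"
    and neQ: "support_face Q (\<sigma> S) \<noteq> {}"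
    and inQ: "\<exists>y\<in>Q. \<sigma> S = Poly_Mapping.keys y" if S: "S \<in> Poly_Mapping.keys ` P" for S
  proof -
    obtain x where x: "x \<in> P" "S = Poly_Mapping.keys x" using S by auto
    show neP: "support_face P S \<noteq> {}" using P.support_face_self[OF x(1)] x(2) by auto
    then show "\<phi> (support_face P S) = support_face Q (\<sigma> S)"
      using P.Union_keys_support_face[OF x(1)] x(2) by (simp add: \<phi>_def)
    have "\<sigma> S \<in> Poly_Mapping.keys ` Q" using S unfolding image[symmetric] by (rule imageI)
    then show inQ: "\<exists>y\<in>Q. \<sigma> S = Poly_Mapping.keys y" by auto
    then show "support_face Q (\<sigma> S) \<noteq> {}" using Q.support_face_self by fastforce
  qed
  have order: "F \<subseteq> G \<longleftrightarrow> \<phi> F \<subseteq> \<phi> G" if F: "F \<in> faces P" and G: "G \<in> faces P" for F G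
  proof -
    have empty: "\<phi> {} = {}" by (simp add: \<phi>_def)
    consider "F = {}" | S where "F = support_face P S" "S \<in> Poly_Mapping.keys ` P" "G = {}"
      | S T where "F = support_face P S" "S \<in> Poly_Mapping.keys ` P"
          "G = support_face P T" "T \<in> Poly_Mapping.keys ` P"
      using F G unfolding P.faces_eq by blast
    then show ?thesis
    proof cases
      case 1
      then show ?thesis by (simp add: empty)
    next
      case 2
      then show ?thesis using \<phi> neP neQ empty by simp
    next
      case 3
      obtain x x' where x: "x \<in> P" "S = Poly_Mapping.keys x" "x' \<in> P" "T = Poly_Mapping.keys x'"
        using 3 by auto
      obtain y y' where y: "y \<in> Q" "\<sigma> S = Poly_Mapping.keys y" "y' \<in> Q" "\<sigma> T = Poly_Mapping.keys y'"
        using 3 inQ by metis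
      have "F \<subseteq> G \<longleftrightarrow> S \<subseteq> T"
        using 3 x P.support_face_subset_iff by simp
      also have "\<dots> \<longleftrightarrow> \<sigma> S \<subseteq> \<sigma> T"
        using 3 mono by simp
      also have "\<dots> \<longleftrightarrow> \<phi> F \<subseteq> \<phi> G"
        using 3 \<phi> y Q.support_face_subset_iff[OF y(1) y(3)] by simp
      finally show ?thesis .
    qed
  qed
  have "inj_on \<phi> (faces P)"
    by (rule inj_onI) (metis order subset_antisym subset_refl)
  moreover have "\<phi> ` faces P = faces Q"
  proof -
    have "\<phi> ` faces P = insert {} (support_face Q ` \<sigma> ` Poly_Mapping.keys ` P)"
      unfolding P.faces_eq image_insert image_image[of \<phi>]
      using \<phi> by (auto simp: \<phi>_def[of "{}"] image_iff)
    then show ?thesis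
      by (simp only: image Q.faces_eq)
  qed
  ultimately show ?thesis
    unfolding face_poset_isomorphic_def bij_betw_def using order by (intro exI[of _ \<phi>]) simp
qed

subsection \<open>Flows with positive netflow on acyclic graphs\<close>

text \<open>Restriction to the coordinates in \<open>B\<close> identifies \<open>L\<close> with the
  functions on \<open>B\<close>: \<open>zero\<close> makes it injective, and the vectors
  \<open>\<delta> e\<close> are preimages of the unit vectors.\<close>

lemma dim_eq_card_dual:
  fixes L :: "('a \<Rightarrow>\<^sub>0 real) set" and \<delta> :: "'a \<Rightarrow> ('a \<Rightarrow>\<^sub>0 real)"
  assumes L: "subspace L" and B: "finite B"
    and mem: "\<And>e. e \<in> B \<Longrightarrow> \<delta> e \<in> L"
    and dual: "\<And>e e'. e \<in> B \<Longrightarrow> e' \<in> B \<Longrightarrow> Poly_Mapping.lookup (\<delta> e) e' = (if e = e' then 1 else 0)"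
    and zero: "\<And>d. d \<in> L \<Longrightarrow> (\<And>e. e \<in> B \<Longrightarrow> Poly_Mapping.lookup d e = 0) \<Longrightarrow> d = 0"
  shows "dim L = card B"
proof (rule dim_unique)
  have lookup: "Poly_Mapping.lookup (\<Sum>e\<in>B. u e *\<^sub>R \<delta> e) e' = u e'" if "e' \<in> B" for u e'
  proof -
    have "Poly_Mapping.lookup (\<Sum>e\<in>B. u e *\<^sub>R \<delta> e) e' = (\<Sum>e\<in>B. if e = e' then u e else 0)"
      unfolding lookup_sum using that dual by (intro sum.cong) auto
    then show ?thesis using that B by simp
  qed
  have inj: "inj_on \<delta> B"
    by (rule inj_onI) (metis dual zero_neq_one)
  show "\<delta> ` B \<subseteq> L" using mem by auto
  show "card (\<delta> ` B) = card B" using inj by (rule card_image)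
  show "independent (\<delta> ` B)"
  proof (rule independent_if_scalars_zero)
    show "finite (\<delta> ` B)" using B by simp
    fix f x assume "(\<Sum>x\<in>\<delta> ` B. f x *\<^sub>R x) = 0" and "x \<in> \<delta> ` B"
    then obtain e where e: "e \<in> B" "x = \<delta> e" and "(\<Sum>e\<in>B. f (\<delta> e) *\<^sub>R \<delta> e) = 0"
      using inj by (auto simp: sum.reindex)
    then show "f x = 0" using lookup[of e "\<lambda>e. f (\<delta> e)"] by simp
  qed
  show "L \<subseteq> span (\<delta> ` B)"
  proof
    fix d assume d: "d \<in> L"
    let ?s = "\<Sum>e\<in>B. Poly_Mapping.lookup d e *\<^sub>R \<delta> e"
    have "?s \<in> L" using L mem by (intro subspace_sum subspace_scale)
    with L d have "d - ?s \<in> L" by (rule subspace_diff)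
    then have "d - ?s = 0" by (rule zero) (simp add: lookup_minus lookup)
    then have "d = ?s" by simp
    moreover have "?s \<in> span (\<delta> ` B)" by (intro span_sum span_scale span_base) auto
    ultimately show "d \<in> span (\<delta> ` B)" by simp
  qed
qed

section \<open>Spaces of flows with arbitrary real netflow\<close>

definition outflow :: "(nat \<times> nat) set \<Rightarrow> ((nat \<times> nat) \<Rightarrow>\<^sub>0 real) \<Rightarrow> nat \<Rightarrow> real" where
  "outflow E x i = (\<Sum>j | (i, j) \<in> E. Poly_Mapping.lookup x (i, j))"

definition inflow :: "(nat \<times> nat) set \<Rightarrow> ((nat \<times> nat) \<Rightarrow>\<^sub>0 real) \<Rightarrow> nat \<Rightarrow> real" where
  "inflow E x i = (\<Sum>g | (g, i) \<in> E. Poly_Mapping.lookup x (g, i))"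

text \<open>Node \<open>n + 1\<close> has no equation, since in the graphs considered its balance
  follows by adding the others. The netflow \<open>b\<close> is a parameter so that the value 0
  gives the space of directions.\<close>

definition flow_space ::
    "nat \<Rightarrow> (nat \<times> nat) set \<Rightarrow> (nat \<Rightarrow> real) \<Rightarrow> ((nat \<times> nat) \<Rightarrow>\<^sub>0 real) set" where
  "flow_space n E b =
     {x. Poly_Mapping.keys x \<subseteq> E \<and> (\<forall>i\<in>{1..n}. inflow E x i + b i = outflow E x i)}"

lemma flow_linear:
  "outflow E (x + y) i = outflow E x i + outflow E y i"
  "inflow E (x + y) i = inflow E x i + inflow E y i"
  "outflow E (c *\<^sub>R x) i = c * outflow E x i"
  "inflow E (c *\<^sub>R x) i = c * inflow E x i"
  by (simp_all add: outflow_def inflow_def lookup_add sum.distrib sum_distrib_left)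

text \<open>With netflows combined along with the flows, closure under affine combinations and the
  passage between flows and directions are instances of one computation.\<close>

lemma flow_space_combine:
  assumes x: "x \<in> flow_space n E b" and y: "y \<in> flow_space n E b'"
  shows "u *\<^sub>R x + v *\<^sub>R y \<in> flow_space n E (\<lambda>i. u * b i + v * b' i)"
proof -
  have "Poly_Mapping.keys (u *\<^sub>R x + v *\<^sub>R y) \<subseteq> E"
    using x y subspace_add[OF subspace_keys_subset, of "u *\<^sub>R x" E "v *\<^sub>R y"]
      subspace_scale[OF subspace_keys_subset, of _ E]
    by (simp add: flow_space_def)
  moreover have "inflow E (u *\<^sub>R x + v *\<^sub>R y) i + (u * b i + v * b' i)
      = outflow E (u *\<^sub>R x + v *\<^sub>R y) i" if "i \<in> {1..n}" for i
  proof -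
    have "outflow E x i = inflow E x i + b i" "outflow E y i = inflow E y i + b' i"
      using x y that by (simp_all add: flow_space_def)
    then show ?thesis
      by (simp add: flow_linear algebra_simps)
  qed
  ultimately show ?thesis by (simp add: flow_space_def)
qed

lemma affine_flow_space: "affine (flow_space n E b)"
  unfolding affine_def
proof (intro ballI allI impI)
  fix x y and u v :: real
  assume "x \<in> flow_space n E b" "y \<in> flow_space n E b" "u + v = 1"
  then show "u *\<^sub>R x + v *\<^sub>R y \<in> flow_space n E b"
    using flow_space_combine[of x n E b y b u v] by (simp flip: distrib_right)
qed

lemma subspace_flow_space: "subspace (flow_space n E (\<lambda>_. 0))"
proof -
  have "0 \<in> flow_space n E (\<lambda>_. 0)"
    by (simp add: flow_space_def inflow_def outflow_def)
  then show ?thesis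
    using affine_flow_space by (simp add: subspace_affine)
qed

lemma flow_space_translate:
  assumes "x \<in> flow_space n E b"
  shows "x + d \<in> flow_space n E b \<longleftrightarrow> d \<in> flow_space n E (\<lambda>_. 0)"
proof
  assume "x + d \<in> flow_space n E b"
  from flow_space_combine[OF this assms, of 1 "-1"] show "d \<in> flow_space n E (\<lambda>_. 0)"
    by simp
next
  assume "d \<in> flow_space n E (\<lambda>_. 0)"
  from flow_space_combine[OF assms this, of 1 1] show "x + d \<in> flow_space n E b"
    by simp
qed

text \<open>
  The throughput at each node of the flow that leaves node \<open>g\<close> along the edge \<open>(g, i)\<close> in proportion
  \<open>c (g, i)\<close>, shifted by \<open>h (g, i)\<close>.
\<close>

fun throughput ::
    "(nat \<times> nat) set \<Rightarrow> (nat \<Rightarrow> real) \<Rightarrow> (nat \<times> nat \<Rightarrow> real) \<Rightarrow> (nat \<times> nat \<Rightarrow> real) \<Rightarrow> nat \<Rightarrow> real" where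
  "throughput E b c h i =
     b i + (\<Sum>g\<in>{g. g < i \<and> (g, i) \<in> E}. throughput E b c h g * c (g, i) + h (g, i))"

declare throughput.simps [simp del]

locale acyclic_graph =
  fixes n :: nat and E :: "(nat \<times> nat) set"
  assumes edges: "E \<subseteq> {(i, j). 1 \<le> i \<and> i < j \<and> j \<le> n + 1}"
begin

lemma edge_less: "(i, j) \<in> E \<Longrightarrow> i < j"
  and edge_source: "(i, j) \<in> E \<Longrightarrow> i \<in> {1..n}"
  and edge_target: "(i, j) \<in> E \<Longrightarrow> j \<in> {1..n + 1}"
  using edges by fastforce+

lemma finite_edges: "finite E"
  by (rule finite_subset[of _ "{1..n} \<times> {1..n + 1}"]) (use edge_source edge_target in auto)

lemma finite_out: "finite {j. (i, j) \<in> E}"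
  by (rule finite_subset[of _ "{1..n + 1}"]) (use edge_target in auto)

lemma finite_in: "finite {g. (g, i) \<in> E}"
  by (rule finite_subset[of _ "{1..n}"]) (use edge_source in auto)

text \<open>Edges into a node come from smaller nodes, so by induction the inflows at it agree, and
  conservation makes the outflows agree before \<open>step\<close> is applied to its outgoing
  edges.\<close>

lemma flow_space_eqI:
  assumes x: "x \<in> flow_space n E b" and y: "y \<in> flow_space n E b"
    and step: "\<And>i j. (i, j) \<in> E \<Longrightarrow> outflow E x i = outflow E y i \<Longrightarrow>
      Poly_Mapping.lookup x (i, j) = Poly_Mapping.lookup y (i, j)"
  shows "x = y"
proof (rule poly_mapping_eqI)
  fix e :: "nat \<times> nat"
  have "\<forall>j. (i, j) \<in> E \<longrightarrow> Poly_Mapping.lookup x (i, j) = Poly_Mapping.lookup y (i, j)" for i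
  proof (induction i rule: less_induct)
    case (less i)
    show ?case
    proof (intro allI impI)
      fix j assume ij: "(i, j) \<in> E"
      have "inflow E x i = inflow E y i"
        unfolding inflow_def using less.IH edge_less by (intro sum.cong) auto
      then have "outflow E x i = outflow E y i"
        using x y edge_source[OF ij] by (auto simp: flow_space_def dest!: bspec[of _ _ i])
      with ij show "Poly_Mapping.lookup x (i, j) = Poly_Mapping.lookup y (i, j)"
        by (rule step)
    qed
  qed
  then show "Poly_Mapping.lookup x e = Poly_Mapping.lookup y e"
  proof (cases "e \<in> E")
    case False
    then have "e \<notin> Poly_Mapping.keys x" "e \<notin> Poly_Mapping.keys y"
      using x y by (auto simp: flow_space_def)
    then show ?thesis by (simp add: in_keys_iff)
  qed (cases e, simp)
qed

text \<open>The proportions \<open>c\<close> pass on the whole throughput of a node, and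
  \<open>h\<close> shifts flow among its outgoing edges without changing the total. With
  \<open>h\<close> zero this yields flows of prescribed support; with \<open>h\<close> a difference
  of two edges, a dual basis of a space of directions.\<close>

lemma obtain_flow:
  assumes c: "\<And>i. i \<in> {1..n} \<Longrightarrow> (\<Sum>j | (i, j) \<in> E. c (i, j)) = 1"
    and h: "\<And>i. i \<in> {1..n} \<Longrightarrow> (\<Sum>j | (i, j) \<in> E. h (i, j)) = 0"
  obtains x t where "x \<in> flow_space n E b"
    and "\<And>i j. (i, j) \<in> E \<Longrightarrow> Poly_Mapping.lookup x (i, j) = t i * c (i, j) + h (i, j)"
    and "\<And>i. t i = inflow E x i + b i"
proof -
  define t where "t = throughput E b c h"
  define F where "F e = (if e \<in> E then t (fst e) * c e + h e else 0)" for e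
  define x where "x = Abs_poly_mapping F"
  have "finite {e. F e \<noteq> 0}"
    by (rule finite_subset[OF _ finite_edges]) (auto simp: F_def)
  then have lookup: "Poly_Mapping.lookup x = F"
    by (simp add: x_def)
  have xE: "Poly_Mapping.lookup x (i, j) = t i * c (i, j) + h (i, j)" if "(i, j) \<in> E" for i j
    using that by (simp add: lookup F_def)
  have t: "t i = inflow E x i + b i" for i
  proof -
    \<comment> \<open>The bound \<open>g < i\<close> in \<open>throughput\<close> makes the
      recursion terminate; edges satisfy it by acyclicity.\<close>
    have "{g. g < i \<and> (g, i) \<in> E} = {g. (g, i) \<in> E}"
      using edge_less by auto
    then show ?thesis
      unfolding t_def inflow_def by (subst throughput.simps) (simp add: xE t_def)
  qed
  have "outflow E x i = t i" if "i \<in> {1..n}" for i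
    using c[OF that] h[OF that]
    by (simp add: outflow_def xE sum.distrib flip: sum_distrib_left)
  moreover have "Poly_Mapping.keys x \<subseteq> E"
    by (auto simp: in_keys_iff lookup F_def split: if_splits)
  ultimately have "x \<in> flow_space n E b"
    by (simp add: flow_space_def t)
  then show thesis using xE t by (rule that)
qed

text \<open>Both sides add the flow over all edges, grouped by source and by target;
  \<open>n + 1\<close> is never a source.\<close>

lemma sum_outflow_eq_sum_inflow:
  "(\<Sum>i = 1..n. outflow E x i) = (\<Sum>i = 1..n + 1. inflow E x i)"
proof -
  have "(\<Sum>i = 1..n. outflow E x i)
      = (\<Sum>e\<in>(SIGMA i:{1..n}. {j. (i, j) \<in> E}). Poly_Mapping.lookup x (fst e, snd e))"
    unfolding outflow_def by (subst sum.Sigma) (auto simp: finite_out case_prod_beta)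
  also have "\<dots> = (\<Sum>e\<in>(SIGMA i:{1..n + 1}. {g. (g, i) \<in> E}). Poly_Mapping.lookup x (snd e, fst e))"
    using edge_source edge_target
    by (intro sum.reindex_bij_witness[of _ prod.swap prod.swap]) auto
  also have "\<dots> = (\<Sum>i = 1..n + 1. inflow E x i)"
    unfolding inflow_def by (subst sum.Sigma) (auto simp: finite_in case_prod_beta)
  finally show ?thesis .
qed

lemma flow_polytope_eq:
  "flow_polytope n E a
     = {x \<in> flow_space n E (\<lambda>i. of_int (a i)). \<forall>e. 0 \<le> Poly_Mapping.lookup x e}"
proof -
  have last: "inflow E x (n + 1) + of_int (netflow n a (n + 1)) = outflow E x (n + 1)"
    if "\<And>i. i \<in> {1..n} \<Longrightarrow> inflow E x i + of_int (a i) = outflow E x i" for x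
  proof -
    have "(\<Sum>i = 1..n. inflow E x i + of_int (a i)) = (\<Sum>i = 1..n. outflow E x i)"
      using that by (intro sum.cong) auto
    also have "\<dots> = (\<Sum>i = 1..n. inflow E x i) + inflow E x (n + 1)"
      unfolding sum_outflow_eq_sum_inflow by simp
    finally have "inflow E x (n + 1) = of_int (\<Sum>i = 1..n. a i)"
      by (simp add: sum.distrib)
    moreover have "{j. (n + 1, j) \<in> E} = {}"
      using edge_source by fastforce
    then have "outflow E x (n + 1) = 0"
      by (simp add: outflow_def)
    ultimately show ?thesis
      by (simp add: netflow_def)
  qed
  have cons: "(\<forall>i\<in>{1..n + 1}. inflow E x i + of_int (netflow n a i) = outflow E x i)
      \<longleftrightarrow> (\<forall>i\<in>{1..n}. inflow E x i + of_int (a i) = outflow E x i)" for x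
  proof -
    have "{1..n + 1} = insert (n + 1) {1..n}" by auto
    moreover have "netflow n a i = a i" if "i \<in> {1..n}" for i
      using that by (simp add: netflow_def)
    ultimately show ?thesis using last by auto
  qed
  have nonneg: "(\<forall>e\<in>E. 0 \<le> Poly_Mapping.lookup x e) \<longleftrightarrow> (\<forall>e. 0 \<le> Poly_Mapping.lookup x e)"
    if "Poly_Mapping.keys x \<subseteq> E" for x :: "(nat \<times> nat) \<Rightarrow>\<^sub>0 real"
    using that by (metis in_keys_iff order_refl subsetD)
  show ?thesis
    unfolding flow_polytope_def flow_space_def
    using cons nonneg by (auto simp: inflow_def outflow_def)
qed

text \<open>Fix one edge \<open>(i, b i)\<close> of \<open>S\<close> at each node. The values on the
  remaining edges, collected in \<open>B\<close>, are free: going through the nodes in order, the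
  fixed edge takes whatever conservation requires.\<close>

lemma dim_flow_space_supported:
  assumes S: "S \<subseteq> E" and cover: "{1..n} \<subseteq> fst ` S"
  shows "dim {d. Poly_Mapping.keys d \<subseteq> S \<and> d \<in> flow_space n E (\<lambda>_. 0)} = card S - n"
    (is "dim ?L = _")
proof -
  have "\<exists>j. (i, j) \<in> S" if "i \<in> {1..n}" for i
    using that cover by fastforce
  then obtain b where b: "\<And>i. i \<in> {1..n} \<Longrightarrow> (i, b i) \<in> S" by metis
  define B where "B = S - (\<lambda>i. (i, b i)) ` {1..n}"
  have finS: "finite S" using S finite_edges by (rule finite_subset)
  have cardB: "card B = card S - n"
    unfolding B_def using b by (subst card_Diff_subset) (auto simp: card_image inj_on_def)
  have "\<exists>d. d \<in> ?L \<and> (\<forall>e'\<in>B. Poly_Mapping.lookup d e' = (if e = e' then 1 else 0))"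
    if "e \<in> B" for e
  proof -
    obtain k l where e: "e = (k, l)" by (cases e)
    have kl: "(k, l) \<in> S" "l \<noteq> b k" "(k, b k) \<in> S" "k \<in> {1..n}"
      using that e b edge_source S by (auto simp: B_def)
    \<comment> \<open>\<open>c\<close> sends the throughput of each node along its fixed edge;
      \<open>h\<close> puts one unit on \<open>(k, l)\<close> and takes it from
      \<open>(k, b k)\<close>. On \<open>B\<close> the resulting flow is the unit vector at
      \<open>e\<close>.\<close>
    define c where "c = (\<lambda>(i, j). if j = b i then 1 else 0 :: real)"
    define h where "h = (\<lambda>(i, j). if i = k \<and> j = l then 1 else if i = k \<and> j = b k then - 1 else 0 :: real)"
    have c1: "(\<Sum>j | (i, j) \<in> E. c (i, j)) = 1" if "i \<in> {1..n}" for i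
      using b[OF that] S by (auto simp: c_def finite_out)
    have h0: "(\<Sum>j | (i, j) \<in> E. h (i, j)) = 0" if "i \<in> {1..n}" for i
    proof (cases "i = k")
      case True
      have "(\<Sum>j | (i, j) \<in> E. h (i, j))
          = (\<Sum>j | (i, j) \<in> E. (if j = l then 1 else 0) - (if j = b k then 1 else 0))"
        using True kl by (intro sum.cong) (auto simp: h_def)
      also have "\<dots> = 0"
        using True kl S by (auto simp: sum_subtractf finite_out)
      finally show ?thesis .
    qed (simp add: h_def)
    obtain d t where d: "d \<in> flow_space n E (\<lambda>_. 0)"
      and l: "\<And>i j. (i, j) \<in> E \<Longrightarrow> Poly_Mapping.lookup d (i, j) = t i * c (i, j) + h (i, j)"
      using obtain_flow[of c h "\<lambda>_. 0", OF c1 h0] by metis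
    have "e' \<in> S" if "e' \<in> Poly_Mapping.keys d" for e'
    proof -
      obtain i j where e': "e' = (i, j)" by (cases e')
      have ij: "(i, j) \<in> E" using that d e' by (auto simp: flow_space_def)
      then have "c (i, j) \<noteq> 0 \<or> h (i, j) \<noteq> 0"
        using that l[OF ij] by (auto simp: in_keys_iff e')
      then show ?thesis
        using kl b[OF edge_source[OF ij]] by (auto simp: c_def h_def e' split: if_splits)
    qed
    moreover have "Poly_Mapping.lookup d e' = (if e = e' then 1 else 0)" if e'B: "e' \<in> B" for e'
    proof -
      obtain i j where e': "e' = (i, j)" by (cases e')
      have ij: "(i, j) \<in> E" using e'B S e' by (auto simp: B_def)
      moreover have "j \<noteq> b i" using e'B e' edge_source[OF ij] by (auto simp: B_def)
      ultimately show ?thesis using l[of i j] by (auto simp: c_def h_def e' e)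
    qed
    ultimately show ?thesis using d by blast
  qed
  then have "\<exists>\<delta>. \<forall>e\<in>B. \<delta> e \<in> ?L \<and>
      (\<forall>e'\<in>B. Poly_Mapping.lookup (\<delta> e) e' = (if e = e' then 1 else 0))"
    by (intro bchoice ballI)
  then obtain \<delta> where \<delta>: "\<And>e. e \<in> B \<Longrightarrow> \<delta> e \<in> ?L"
      "\<And>e e'. e \<in> B \<Longrightarrow> e' \<in> B \<Longrightarrow> Poly_Mapping.lookup (\<delta> e) e' = (if e = e' then 1 else 0)"
    by blast
  have sub: "subspace ?L"
    using subspace_inter[OF subspace_keys_subset subspace_flow_space]
    by (simp add: Int_def)
  have "d = 0" if d: "d \<in> ?L" and B0: "\<And>e. e \<in> B \<Longrightarrow> Poly_Mapping.lookup d e = 0" for d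
  proof (rule flow_space_eqI[of _ "\<lambda>_. 0"])
    show "d \<in> flow_space n E (\<lambda>_. 0)" using d by simp
    show "0 \<in> flow_space n E (\<lambda>_. 0)" using subspace_flow_space by (rule subspace_0)
    fix i j assume ij: "(i, j) \<in> E" and out: "outflow E d i = outflow E 0 i"
    have 0: "Poly_Mapping.lookup d (i, j') = 0" if "j' \<noteq> b i" for j'
    proof (cases "(i, j') \<in> S")
      case True
      then show ?thesis using that by (intro B0) (auto simp: B_def)
    next
      case False
      then show ?thesis using d by (auto simp: in_keys_iff)
    qed
    have "(i, b i) \<in> E" using b[OF edge_source[OF ij]] S by auto
    \<comment> \<open>The other edges leaving \<open>i\<close> carry nothing, so the whole outflow,
      which is zero by \<open>out\<close>, sits on the fixed edge.\<close>
    then have "outflow E d i = Poly_Mapping.lookup d (i, b i)"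
      unfolding outflow_def
      by (subst sum.mono_neutral_right[of _ "{b i}"]) (auto simp: finite_out 0)
    with out 0 show "Poly_Mapping.lookup d (i, j) = Poly_Mapping.lookup 0 (i, j)"
      by (cases "j = b i") (simp_all add: outflow_def)
  qed
  with sub finS \<delta> have "dim ?L = card B"
    by (intro dim_eq_card_dual[of _ _ \<delta>]) (auto simp: B_def)
  then show ?thesis by (simp add: cardB)
qed

end

section \<open>The flow polytope and its supports\<close>

locale positive_flow = acyclic_graph +
  fixes a :: "nat \<Rightarrow> int"
  assumes netflow_pos: "i \<in> {1..n} \<Longrightarrow> 0 < a i"
    and out_edge: "{1..n} \<subseteq> fst ` E"
begin

abbreviation "P \<equiv> flow_polytope n E a"

abbreviation "A \<equiv> flow_space n E (\<lambda>i. of_int (a i))"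

definition "supports = {S. S \<subseteq> E \<and> {1..n} \<subseteq> fst ` S}"

sublocale standard_form A P E
proof
  show "finite E" by (rule finite_edges)
  show "affine A" by (rule affine_flow_space)
  show "Poly_Mapping.keys x \<subseteq> E" if "x \<in> A" for x
    using that by (simp add: flow_space_def)
  show "P = {x \<in> A. \<forall>e. 0 \<le> Poly_Mapping.lookup x e}"
    by (rule flow_polytope_eq)
qed

text \<open>If two flows have equal outflow at a node, a coordinatewise inequality between them
  cannot be strict on any edge leaving it.\<close>

lemma polytope_flow: "polytope P"
proof (rule polytope_P)
  fix x y assume x: "x \<in> A" and y: "y \<in> A"
    and le: "\<And>e. Poly_Mapping.lookup x e \<le> Poly_Mapping.lookup y e"
  show "x = y"
    using x y
  proof (rule flow_space_eqI)
    fix i j assume "(i, j) \<in> E" "outflow E x i = outflow E y i"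
    then show "Poly_Mapping.lookup x (i, j) = Poly_Mapping.lookup y (i, j)"
      unfolding outflow_def using le finite_out
      by (intro sum_mono_inv[of "\<lambda>j. Poly_Mapping.lookup x (i, j)" "{j. (i, j) \<in> E}"]) auto
  qed
qed

lemma keys_image_flow: "Poly_Mapping.keys ` P = supports"
proof (intro equalityI subsetI)
  fix S assume "S \<in> Poly_Mapping.keys ` P"
  then obtain x where x: "x \<in> P" "S = Poly_Mapping.keys x" by auto
  have "i \<in> fst ` Poly_Mapping.keys x" if i: "i \<in> {1..n}" for i
  proof (rule ccontr)
    assume "i \<notin> fst ` Poly_Mapping.keys x"
    then have "(i, j) \<notin> Poly_Mapping.keys x" for j by force
    then have "outflow E x i = 0" by (simp add: outflow_def in_keys_iff)
    moreover have "inflow E x i \<ge> 0"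
      unfolding inflow_def by (intro sum_nonneg P_nonneg x)
    moreover have "inflow E x i + of_int (a i) = outflow E x i"
      using P_in_A[OF x(1)] i by (simp add: flow_space_def)
    ultimately show False using netflow_pos[OF i] by simp
  qed
  then show "S \<in> supports"
    using keys_subset x by (auto simp: supports_def)
next
  fix S assume "S \<in> supports"
  then have S: "S \<subseteq> E" and cover: "{1..n} \<subseteq> fst ` S" by (auto simp: supports_def)
  define N where "N i = {j. (i, j) \<in> S}" for i
  have fin: "finite (N i)" for i
    by (rule finite_subset[OF _ finite_out[of i]]) (use S in \<open>auto simp: N_def\<close>)
  have ne: "N i \<noteq> {}" if "i \<in> {1..n}" for i
    using that cover by (fastforce simp: N_def)
  \<comment> \<open>Each node divides its throughput equally among its edges in
    \<open>S\<close>.\<close>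
  define c where "c = (\<lambda>(i, j). if (i, j) \<in> S then 1 / real (card (N i)) else 0)"
  have "(\<Sum>j | (i, j) \<in> E. c (i, j)) = 1" if "i \<in> {1..n}" for i
  proof -
    have "(\<Sum>j | (i, j) \<in> E. c (i, j)) = (\<Sum>j\<in>N i. 1 / real (card (N i)))"
      using S by (intro sum.mono_neutral_cong_right) (auto simp: N_def c_def finite_out)
    then show ?thesis using fin[of i] ne[OF that] by simp
  qed
  then obtain x t where x: "x \<in> A"
    and l: "\<And>i j. (i, j) \<in> E \<Longrightarrow> Poly_Mapping.lookup x (i, j) = t i * c (i, j)"
    and t: "\<And>i. t i = inflow E x i + of_int (a i)"
    using obtain_flow[of c "\<lambda>_. 0" "\<lambda>i. of_int (a i)"] by auto
  have c0: "c e \<ge> 0" for e by (cases e) (simp add: c_def)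
  \<comment> \<open>Positivity of the netflow enters here: by induction the inflow is nonnegative,
    so every throughput is positive and no edge of \<open>S\<close> is left without flow.\<close>
  have tpos: "t i > 0" if "i \<in> {1..n}" for i
    using that
  proof (induction i rule: less_induct)
    case (less i)
    have "inflow E x i \<ge> 0"
      unfolding inflow_def
    proof (rule sum_nonneg)
      fix g assume "g \<in> {g. (g, i) \<in> E}"
      then have gi: "(g, i) \<in> E" by simp
      show "0 \<le> Poly_Mapping.lookup x (g, i)"
        using less.IH[OF edge_less[OF gi] edge_source[OF gi]] c0 by (simp add: l[OF gi])
    qed
    then show ?case using netflow_pos[OF less.prems] by (simp add: t)
  qed
  have mem: "0 \<le> Poly_Mapping.lookup x e \<and> (Poly_Mapping.lookup x e \<noteq> 0 \<longleftrightarrow> e \<in> S)" for e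
  proof (cases "e \<in> E")
    case True
    obtain i j where e: "e = (i, j)" by (cases e)
    have i: "i \<in> {1..n}" using True e edge_source by auto
    have "card (N i) > 0" using fin ne[OF i] by (simp add: card_gt_0_iff)
    then have "c e \<noteq> 0 \<longleftrightarrow> e \<in> S" by (simp add: c_def e)
    then show ?thesis using True tpos[OF i] c0[of e] l[of i j] by (simp add: e)
  next
    case False
    then have "Poly_Mapping.lookup x e = 0"
      using keys_A[OF x] by (auto simp: in_keys_iff)
    then show ?thesis using False S by auto
  qed
  then have "x \<in> P" using x by (simp add: P_eq)
  moreover have "Poly_Mapping.keys x = S" using mem by (auto simp: in_keys_iff)
  ultimately show "S \<in> Poly_Mapping.keys ` P" by blast
qed

lemma direction_dim_support_face:
  assumes "S \<in> supports"
  shows "direction_dim (support_face P S) = card S - n"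
proof -
  obtain x where x: "x \<in> P" "S = Poly_Mapping.keys x"
    using assms keys_image_flow by (metis imageE)
  have "direction_dim (support_face P S)
      = dim (span {u - v | u v. u \<in> support_face P S \<and> v \<in> support_face P S})"
    by (simp add: direction_dim_def)
  also have "\<dots> = dim {d. Poly_Mapping.keys d \<subseteq> S \<and> d \<in> flow_space n E (\<lambda>_. 0)}"
    unfolding x(2) span_differences_support_face[OF x(1)] flow_space_translate[OF P_in_A[OF x(1)]] ..
  also have "\<dots> = card S - n"
    using assms by (intro dim_flow_space_supported) (auto simp: supports_def)
  finally show ?thesis .
qed

text \<open>Guards the truncated subtraction in \<open>card S - n\<close>.\<close>

lemma card_supports_ge:
  assumes "S \<in> supports"
  shows "n \<le> card S"
proof -
  have "finite S" using assms finite_edges by (auto simp: supports_def intro: finite_subset)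
  then show ?thesis
    using assms surj_card_le[of S "{1..n}" fst] by (simp add: supports_def)
qed

lemma E_in_supports: "E \<in> supports"
  using out_edge by (simp add: supports_def)

lemma support_face_E: "support_face P E = P"
  using keys_subset by (auto simp: support_face_def)

lemma direction_dim_flow: "direction_dim P = card E - n"
  using direction_dim_support_face[OF E_in_supports] by (simp add: support_face_E)

lemma faces_flow_eq: "faces P = insert {} (support_face P ` supports)"
  using faces_eq by (simp only: keys_image_flow)

lemma inj_on_support_face: "inj_on (support_face P) supports"
  using support_face_inj_on by (simp only: keys_image_flow)

lemma support_face_nonempty: "S \<in> supports \<Longrightarrow> support_face P S \<noteq> {}"
  using support_face_self unfolding keys_image_flow[symmetric] by fastforce

text \<open>The support of a vertex has exactly one edge out of each node. The edges of the polytope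
  at this vertex enlarge the support by one edge of the graph, and any edge will do, as supports are
  closed under enlargement within \<open>E\<close>. This leaves \<open>card E - n\<close> choices,
  the dimension.\<close>

lemma simple_polytope_flow: "simple_polytope P"
  unfolding simple_polytope_def
proof (intro conjI allI impI)
  show "polytope P" by (rule polytope_flow)
next
  fix v assume v: "v extreme_point_of P"
  define S where "S = Poly_Mapping.keys v"
  have vP: "v \<in> P" using v by (simp add: extreme_point_of_def)
  have S: "S \<in> supports" using vP keys_image_flow by (auto simp: S_def)
  have SE: "S \<subseteq> E" using S by (simp add: supports_def)
  have "{v} \<in> faces P" using v by (simp add: faces_def face_of_singleton)
  then obtain x where x: "x \<in> P" "{v} = support_face P (Poly_Mapping.keys x)"
    using face_of_imp_support_face[of "{v}"] by (auto simp: faces_def)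
  then have "v = x" using support_face_self[OF x(1)] by auto
  then have "support_face P S = {v}" using x by (simp add: S_def)
  moreover have "dim {0 :: (nat \<times> nat) \<Rightarrow>\<^sub>0 real} = 0"
    by (rule dim_unique[of "{}"]) (simp_all add: independent_empty)
  ultimately have "card S - n = 0"
    using direction_dim_support_face[OF S] by (simp add: direction_dim_def)
  then have cardS: "card S = n" using card_supports_ge[OF S] by simp
  have "{F \<in> faces P. v \<in> F \<and> direction_dim F = 1}
      = support_face P ` {T \<in> supports. S \<subseteq> T \<and> card T = n + 1}" (is "?F = _ ` ?T")
  proof (intro equalityI subsetI)
    fix F assume "F \<in> ?F"
    then obtain T where T: "T \<in> supports" "F = support_face P T"
      and vF: "v \<in> F" and dim1: "direction_dim F = 1"
      unfolding faces_flow_eq by auto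
    then have "card T - n = 1" using direction_dim_support_face by simp
    moreover have "S \<subseteq> T" using vF T by (simp add: support_face_def S_def)
    ultimately show "F \<in> support_face P ` ?T" using T by auto
  next
    fix F assume "F \<in> support_face P ` ?T"
    then obtain T where "T \<in> supports" "F = support_face P T" "S \<subseteq> T" "card T = n + 1" by auto
    then show "F \<in> ?F"
      using direction_dim_support_face[of T] vP
      by (auto simp: faces_flow_eq support_face_def S_def)
  qed
  moreover have "?T = (\<lambda>e. insert e S) ` (E - S)"
  proof (intro equalityI subsetI)
    fix T assume T: "T \<in> ?T"
    then have "finite T" using finite_edges by (auto simp: supports_def intro: finite_subset)
    moreover from this T have "finite S" by (auto intro: finite_subset)
    ultimately have "card (T - S) = 1" using cardS T by (simp add: card_Diff_subset)
    then obtain e where "T - S = {e}" by (rule card_1_singletonE)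
    then have "T = insert e S" and "e \<in> E - S" using T by (auto simp: supports_def)
    then show "T \<in> (\<lambda>e. insert e S) ` (E - S)" by blast
  next
    fix T assume "T \<in> (\<lambda>e. insert e S) ` (E - S)"
    then obtain e where e: "e \<in> E - S" "T = insert e S" by auto
    have "finite S" using SE finite_edges by (rule finite_subset)
    then show "T \<in> ?T" using e S cardS by (auto simp: supports_def)
  qed
  moreover have "inj_on (\<lambda>e. insert e S) (E - S)" by (auto simp: inj_on_def)
  moreover have "inj_on (support_face P) ?T"
    by (rule inj_on_subset[OF inj_on_support_face]) auto
  ultimately have "card ?F = card (E - S)" by (simp add: card_image)
  also have "\<dots> = card E - n"
    using SE cardS finite_edges by (simp add: card_Diff_subset finite_subset)
  finally show "card ?F = direction_dim P" by (simp add: direction_dim_flow)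
qed

section \<open>The h-polynomial as a product over the nodes\<close>

lemma f_number_flow: "f_number P i = card {S \<in> supports. card S - n = i}"
proof -
  have "{F \<in> faces P. F \<noteq> {} \<and> direction_dim F = i}
      = support_face P ` {S \<in> supports. card S - n = i}"
    unfolding faces_flow_eq using support_face_nonempty direction_dim_support_face by auto
  moreover have "inj_on (support_face P) {S \<in> supports. card S - n = i}"
    by (rule inj_on_subset[OF inj_on_support_face]) auto
  ultimately show ?thesis by (simp add: f_number_def card_image)
qed

lemma h_polynomial_eq_sum_supports:
  "h_polynomial P = (\<Sum>S\<in>supports. ([:0, 1:] - 1) ^ (card S - n))"
proof -
  have fin: "finite supports" using finite_supports by (simp only: keys_image_flow)
  have "of_nat (f_number P i) * ([:0, 1:] - 1) ^ i
      = (\<Sum>S | S \<in> supports \<and> card S - n = i. ([:0, 1:] - 1 :: int poly) ^ (card S - n))" for i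
    by (simp add: f_number_flow)
  then have "h_polynomial P = (\<Sum>i = 0..direction_dim P.
      \<Sum>S | S \<in> supports \<and> card S - n = i. ([:0, 1:] - 1) ^ (card S - n))"
    unfolding h_polynomial_def by (intro sum.cong refl)
  also have "\<dots> = (\<Sum>S\<in>supports. ([:0, 1:] - 1) ^ (card S - n))"
  proof (rule sum.group[OF fin])
    show "(\<lambda>S. card S - n) ` supports \<subseteq> {0..direction_dim P}"
      unfolding direction_dim_flow using finite_edges
      by (auto simp: supports_def intro!: diff_le_mono card_mono)
  qed simp
  finally show ?thesis .
qed

end

text \<open>A subset \<open>S\<close> of the disjoint union amounts to the family of its parts
  \<open>S \<inter> B i\<close>; cardinalities add, so powers multiply.\<close>

lemma prod_sum_nonempty_subsets:
  fixes y :: "'b::comm_semiring_1"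
  assumes I: "finite I" and fin: "\<And>i. i \<in> I \<Longrightarrow> finite (B i)"
    and disj: "disjoint_family_on B I"
  shows "(\<Prod>i\<in>I. \<Sum>T\<in>Pow (B i) - {{}}. y ^ card T)
       = (\<Sum>S | S \<subseteq> \<Union> (B ` I) \<and> (\<forall>i\<in>I. S \<inter> B i \<noteq> {}). y ^ card S)"
proof -
  have inter: "\<Union> (g ` I) \<inter> B i = g i" if "\<And>i. i \<in> I \<Longrightarrow> g i \<subseteq> B i" "i \<in> I" for g i
    using that disj by (fastforce simp: disjoint_family_on_def)
  have "(\<Prod>i\<in>I. \<Sum>T\<in>Pow (B i) - {{}}. y ^ card T)
      = (\<Sum>g\<in>PiE I (\<lambda>i. Pow (B i) - {{}}). \<Prod>i\<in>I. y ^ card (g i))"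
    using I fin by (intro prod_sum_PiE) auto
  also have "\<dots> = (\<Sum>S | S \<subseteq> \<Union> (B ` I) \<and> (\<forall>i\<in>I. S \<inter> B i \<noteq> {}). y ^ card S)"
  proof (rule sum.reindex_bij_witness[of _ "\<lambda>S. \<lambda>i\<in>I. S \<inter> B i" "\<lambda>g. \<Union> (g ` I)"])
    fix g assume g: "g \<in> PiE I (\<lambda>i. Pow (B i) - {{}})"
    then have sub: "g i \<subseteq> B i" and ne: "g i \<noteq> {}" if "i \<in> I" for i
      using that by (auto simp: PiE_iff)
    show "(\<lambda>i\<in>I. \<Union> (g ` I) \<inter> B i) = g"
      using g by (intro extensionalityI[of _ I]) (auto simp: inter[OF sub] PiE_iff)
    show "\<Union> (g ` I) \<in> {S. S \<subseteq> \<Union> (B ` I) \<and> (\<forall>i\<in>I. S \<inter> B i \<noteq> {})}"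
      using sub ne inter[OF sub] by auto
    have "g i \<inter> g j = {}" if "i \<in> I" "j \<in> I" "i \<noteq> j" for i j
      using disjoint_family_onD[OF disj that] sub[OF that(1)] sub[OF that(2)] by blast
    moreover have "finite (g i)" if "i \<in> I" for i
      using sub[OF that] fin[OF that] by (rule finite_subset)
    ultimately have "card (\<Union> (g ` I)) = (\<Sum>i\<in>I. card (g i))"
      using I by (intro card_UN_disjoint) simp_all
    then show "y ^ card (\<Union> (g ` I)) = (\<Prod>i\<in>I. y ^ card (g i))"
      by (simp add: power_sum)
  next
    fix S assume S: "S \<in> {S. S \<subseteq> \<Union> (B ` I) \<and> (\<forall>i\<in>I. S \<inter> B i \<noteq> {})}"
    then show "\<Union> ((\<lambda>i\<in>I. S \<inter> B i) ` I) = S" by auto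
    show "(\<lambda>i\<in>I. S \<inter> B i) \<in> PiE I (\<lambda>i. Pow (B i) - {{}})"
      using S by auto
  qed
  finally show ?thesis .
qed

text \<open>By binomial expansion all subsets together give \<open>((x - 1) + 1) ^ card B\<close>;
  removing the empty set leaves \<open>x ^ card B - 1\<close>, a geometric sum times
  \<open>x - 1\<close>.\<close>

lemma sum_power_card_nonempty_subsets:
  fixes x :: "'b::comm_ring_1"
  assumes "finite B"
  shows "(\<Sum>T\<in>Pow B - {{}}. (x - 1) ^ card T) = (x - 1) * (\<Sum>j<card B. x ^ j)"
proof -
  have "(\<Sum>T\<in>Pow B. (x - 1) ^ card T) = x ^ card B"
    using prod_add[OF assms, of "\<lambda>_. x - 1" "\<lambda>_. 1"] by simp
  moreover have "(\<Sum>T\<in>Pow B. (x - 1) ^ card T) = 1 + (\<Sum>T\<in>Pow B - {{}}. (x - 1) ^ card T)"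
    using assms by (subst sum.remove[of _ "{}"]) auto
  ultimately have "1 + (\<Sum>T\<in>Pow B - {{}}. (x - 1) ^ card T) = x ^ card B"
    by metis
  then show ?thesis
    unfolding power_diff_1_eq[symmetric] by (simp add: algebra_simps)
qed

text \<open>Multiplying by \<open>(X - 1) ^ n\<close> replaces the exponents
  \<open>card S - n\<close> by \<open>card S\<close>, a plain sum over the nodes. Each node then
  returns one factor \<open>X - 1\<close>, and these cancel because integer polynomials have no zero
  divisors.\<close>

lemma (in positive_flow) h_polynomial_flow:
  "h_polynomial P = (\<Prod>i = 1..n. \<Sum>j<card {j. (i, j) \<in> E}. [:0, 1:] ^ j)"
proof -
  define X :: "int poly" where "X = [:0, 1:]"
  define B where "B i = {e \<in> E. fst e = i}" for i
  have "bij_betw (Pair i) {j. (i, j) \<in> E} (B i)" for i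
    by (auto simp: bij_betw_def inj_on_def B_def)
  then have cardB: "card (B i) = card {j. (i, j) \<in> E}" for i
    by (metis bij_betw_same_card)
  have "\<Union> (B ` {1..n}) = E"
    using edge_source by (fastforce simp: B_def)
  then have supp: "supports = {S. S \<subseteq> \<Union> (B ` {1..n}) \<and> (\<forall>i\<in>{1..n}. S \<inter> B i \<noteq> {})}"
    by (fastforce simp: supports_def B_def)
  have "(X - 1) ^ n * h_polynomial P = (\<Sum>S\<in>supports. (X - 1) ^ card S)"
    unfolding h_polynomial_eq_sum_supports sum_distrib_left X_def
    using card_supports_ge by (intro sum.cong) (simp_all flip: power_add)
  also have "\<dots> = (\<Prod>i = 1..n. \<Sum>T\<in>Pow (B i) - {{}}. (X - 1) ^ card T)"
    unfolding supp using finite_edges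
    by (intro prod_sum_nonempty_subsets[symmetric]) (auto simp: B_def disjoint_family_on_def)
  also have "\<dots> = (\<Prod>i = 1..n. (X - 1) * (\<Sum>j<card {j. (i, j) \<in> E}. X ^ j))"
    using finite_edges
    by (intro prod.cong refl)
      (simp only: cardB[symmetric], intro sum_power_card_nonempty_subsets, simp add: B_def)
  also have "\<dots> = (X - 1) ^ n * (\<Prod>i = 1..n. \<Sum>j<card {j. (i, j) \<in> E}. X ^ j)"
    by (simp add: prod.distrib)
  finally have "(X - 1) ^ n * h_polynomial P
      = (X - 1) ^ n * (\<Prod>i = 1..n. \<Sum>j<card {j. (i, j) \<in> E}. X ^ j)" .
  moreover have "X - 1 \<noteq> 0" by (simp add: X_def one_pCons)
  ultimately show ?thesis by (simp add: X_def)
qed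

subsection \<open>Products of simplices and partition graphs\<close>

definition product_support :: "nat list \<Rightarrow> (nat \<times> nat) set" where
  "product_support lam = {(i, j). i \<in> {1..length lam} \<and> j \<le> ith_part lam i}"

lemma finite_product_support: "finite (product_support lam)"
proof -
  have "product_support lam = (SIGMA i:{1..length lam}. {..ith_part lam i})"
    by (auto simp: product_support_def)
  then show ?thesis by simp
qed

lemma standard_form_simplex_product:
  "standard_form
     {x. Poly_Mapping.keys x \<subseteq> product_support lam \<and>
         (\<forall>i\<in>{1..length lam}. (\<Sum>j\<le>ith_part lam i. Poly_Mapping.lookup x (i, j)) = 1)}
     (simplex_product lam) (product_support lam)"
proof
  let ?B = "{x :: (nat \<times> nat) \<Rightarrow>\<^sub>0 real. Poly_Mapping.keys x \<subseteq> product_support lam \<and>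
         (\<forall>i\<in>{1..length lam}. (\<Sum>j\<le>ith_part lam i. Poly_Mapping.lookup x (i, j)) = 1)}"
  show "finite (product_support lam)" by (rule finite_product_support)
  show "Poly_Mapping.keys x \<subseteq> product_support lam" if "x \<in> ?B" for x using that by simp
  show "affine ?B"
    unfolding affine_def
  proof (intro ballI allI impI)
    fix x y and u v :: real
    assume x: "x \<in> ?B" and y: "y \<in> ?B" and uv: "u + v = 1"
    have "Poly_Mapping.keys (u *\<^sub>R x + v *\<^sub>R y) \<subseteq> product_support lam"
      using x y subspace_add[OF subspace_keys_subset, of "u *\<^sub>R x" "product_support lam" "v *\<^sub>R y"]
        subspace_scale[OF subspace_keys_subset, of _ "product_support lam"]
      by simp
    moreover have "(\<Sum>j\<le>ith_part lam i. Poly_Mapping.lookup (u *\<^sub>R x + v *\<^sub>R y) (i, j)) = 1"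
      if i: "i \<in> {1..length lam}" for i
    proof -
      have "(\<Sum>j\<le>ith_part lam i. Poly_Mapping.lookup x (i, j)) = 1"
        "(\<Sum>j\<le>ith_part lam i. Poly_Mapping.lookup y (i, j)) = 1"
        using x y i by blast+
      then show ?thesis
        using uv by (simp add: lookup_add sum.distrib flip: sum_distrib_left)
    qed
    ultimately show "u *\<^sub>R x + v *\<^sub>R y \<in> ?B" by simp
  qed
  show "simplex_product lam = {x \<in> ?B. \<forall>e. 0 \<le> Poly_Mapping.lookup x e}"
  proof (intro equalityI subsetI)
    fix x assume x: "x \<in> simplex_product lam"
    have out: "Poly_Mapping.lookup x (i, j) = 0" if "i \<notin> {1..length lam}" for i j
      using x that unfolding simplex_product_def by blast
    have "(\<lambda>j. Poly_Mapping.lookup x (i, j)) \<in> standard_simplex (ith_part lam i)"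
      if "i \<in> {1..length lam}" for i
      using x that unfolding simplex_product_def by blast
    then have inn: "0 \<le> Poly_Mapping.lookup x (i, j)"
      "ith_part lam i < j \<Longrightarrow> Poly_Mapping.lookup x (i, j) = 0"
      "(\<Sum>j\<le>ith_part lam i. Poly_Mapping.lookup x (i, j)) = 1"
      if "i \<in> {1..length lam}" for i j
      using that by (simp_all add: standard_simplex_def)
    have "0 \<le> Poly_Mapping.lookup x e \<and> (Poly_Mapping.lookup x e \<noteq> 0 \<longrightarrow> e \<in> product_support lam)" for e
    proof (cases e)
      case (Pair i j)
      show ?thesis
      proof (cases "i \<in> {1..length lam}")
        case True
        then show ?thesis using inn(1,2)[OF True, of j] Pair
          by (auto simp: product_support_def not_le[symmetric])
      next
        case False
        then show ?thesis using out Pair by simp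
      qed
    qed
    then show "x \<in> {x \<in> ?B. \<forall>e. 0 \<le> Poly_Mapping.lookup x e}"
      using inn(3) by (auto simp only: in_keys_iff mem_Collect_eq)
  next
    fix x assume "x \<in> {x \<in> ?B. \<forall>e. 0 \<le> Poly_Mapping.lookup x e}"
    then have keys: "Poly_Mapping.keys x \<subseteq> product_support lam"
      and one: "\<And>i. i \<in> {1..length lam} \<Longrightarrow> (\<Sum>j\<le>ith_part lam i. Poly_Mapping.lookup x (i, j)) = 1"
      and nonneg: "\<And>e. 0 \<le> Poly_Mapping.lookup x e" by blast+
    have zero: "Poly_Mapping.lookup x (i, j) = 0" if "(i, j) \<notin> product_support lam" for i j
      using that keys by (metis in_keys_iff subsetD)
    have "(\<lambda>j. Poly_Mapping.lookup x (i, j)) \<in> standard_simplex (ith_part lam i)"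
      if i: "i \<in> {1..length lam}" for i
    proof -
      \<comment> \<open>The definition of \<open>standard_simplex\<close> also bounds each
        coordinate by 1; here this follows from nonnegative terms with sum 1.\<close>
      have "Poly_Mapping.lookup x (i, j) \<le> 1" for j
      proof (cases "j \<le> ith_part lam i")
        case True
        then have "Poly_Mapping.lookup x (i, j) \<le> (\<Sum>j\<le>ith_part lam i. Poly_Mapping.lookup x (i, j))"
          by (intro member_le_sum[of _ _ "\<lambda>j. Poly_Mapping.lookup x (i, j)"]) (auto simp: nonneg)
        then show ?thesis using one[OF i] by simp
      next
        case False
        then show ?thesis using zero by (simp add: product_support_def)
      qed
      then show ?thesis
        using one[OF i] nonneg zero by (auto simp: standard_simplex_def product_support_def)
    qed
    moreover have "Poly_Mapping.lookup x (i, j) = 0" if "i \<notin> {1..length lam}" for i j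
      using that by (intro zero) (auto simp: product_support_def)
    ultimately show "x \<in> simplex_product lam" unfolding simplex_product_def by blast
  qed
qed

lemma keys_image_simplex_product:
  "Poly_Mapping.keys ` simplex_product lam
     = {S. S \<subseteq> product_support lam \<and> {1..length lam} \<subseteq> fst ` S}"
proof -
  interpret Q: standard_form
    "{x. Poly_Mapping.keys x \<subseteq> product_support lam \<and>
         (\<forall>i\<in>{1..length lam}. (\<Sum>j\<le>ith_part lam i. Poly_Mapping.lookup x (i, j)) = 1)}"
    "simplex_product lam" "product_support lam"
    by (rule standard_form_simplex_product)
  show ?thesis
  proof (intro equalityI subsetI)
    fix S assume "S \<in> Poly_Mapping.keys ` simplex_product lam"
    then obtain x where x: "x \<in> simplex_product lam" "S = Poly_Mapping.keys x" by auto
    have "i \<in> fst ` S" if i: "i \<in> {1..length lam}" for i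
    proof (rule ccontr)
      assume "i \<notin> fst ` S"
      then have "(i, j) \<notin> Poly_Mapping.keys x" for j using x(2) by force
      then have "(\<Sum>j\<le>ith_part lam i. Poly_Mapping.lookup x (i, j)) = 0"
        by (simp add: in_keys_iff)
      moreover have "(\<Sum>j\<le>ith_part lam i. Poly_Mapping.lookup x (i, j)) = 1"
        using Q.P_in_A[OF x(1)] i by blast
      ultimately show False by simp
    qed
    then show "S \<in> {S. S \<subseteq> product_support lam \<and> {1..length lam} \<subseteq> fst ` S}"
      using Q.keys_subset x by auto
  next
    fix S assume "S \<in> {S. S \<subseteq> product_support lam \<and> {1..length lam} \<subseteq> fst ` S}"
    then have S: "S \<subseteq> product_support lam" and cover: "{1..length lam} \<subseteq> fst ` S" by auto
    define N where "N i = {j. (i, j) \<in> S}" for i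
    have sub: "N i \<subseteq> {..ith_part lam i}" for i
      using S by (auto simp: N_def product_support_def)
    then have fin: "finite (N i)" for i by (rule finite_subset) simp
    have ne: "N i \<noteq> {}" if "i \<in> {1..length lam}" for i
      using that cover by (fastforce simp: N_def)
    \<comment> \<open>Equal weights on the chosen vertices: the barycentre of the chosen face in
      each simplex.\<close>
    define F where "F e = (if e \<in> S then 1 / real (card (N (fst e))) else 0)" for e
    define x where "x = Abs_poly_mapping F"
    have "finite {e. F e \<noteq> 0}"
      by (rule finite_subset[OF _ finite_subset[OF S finite_product_support]]) (auto simp: F_def)
    then have lookup: "Poly_Mapping.lookup x = F" by (simp add: x_def)
    have nz: "F e \<noteq> 0 \<longleftrightarrow> e \<in> S" for e
    proof -
      have "card (N (fst e)) > 0" if "e \<in> S"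
        using that fin by (cases e) (auto simp: N_def card_gt_0_iff)
      then show ?thesis by (simp add: F_def)
    qed
    have keys: "Poly_Mapping.keys x = S" by (auto simp: in_keys_iff lookup nz)
    have "(\<Sum>j\<le>ith_part lam i. Poly_Mapping.lookup x (i, j)) = 1" if i: "i \<in> {1..length lam}" for i
    proof -
      have "(\<Sum>j\<le>ith_part lam i. Poly_Mapping.lookup x (i, j)) = (\<Sum>j\<in>N i. 1 / real (card (N i)))"
        using sub by (intro sum.mono_neutral_cong_right) (auto simp: N_def lookup F_def)
      then show ?thesis using fin[of i] ne[OF i] by simp
    qed
    then have "x \<in> simplex_product lam"
      unfolding Q.P_eq using keys S by (auto simp: lookup F_def)
    then show "S \<in> Poly_Mapping.keys ` simplex_product lam" using keys by blast
  qed
qed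

lemma sum_list_eq_sum_ith_part: "sum_list lam = (\<Sum>i = 1..length lam. ith_part lam i)"
proof -
  have "sum_list lam = (\<Sum>i = 0..<length lam. lam ! i)"
    by (rule sum_list_sum_nth)
  also have "\<dots> = (\<Sum>i = 1..length lam. ith_part lam i)"
    by (rule sum.reindex_bij_witness[of _ "\<lambda>i. i - 1" Suc]) (auto simp: ith_part_def)
  finally show ?thesis .
qed

section \<open>Specialization to partition graphs\<close>

context
  fixes lam :: "nat list" and n :: nat and a :: "nat \<Rightarrow> int"
  assumes bound: "\<forall>i\<in>{1..length lam}. int n - int i \<ge> int (ith_part lam i)"
    and netflow: "\<forall>i\<in>{1..n}. a i > 0"
begin

lemma part_bound: "i \<in> {1..length lam} \<Longrightarrow> i + ith_part lam i \<le> n"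
  using bound by force

lemma length_le: "length lam \<le> n"
  using part_bound[of "length lam"] by (cases lam) auto

text \<open>By the bound on the parts, the smallest target \<open>n + 1 - ith_part lam i\<close>
  exceeds \<open>i\<close>, so edges point upwards; the edges to \<open>n + 1\<close> give every
  other node an exit.\<close>

lemma positive_flow_partition_graph: "positive_flow n (partition_graph lam n) a"
proof
  show "partition_graph lam n \<subseteq> {(i, j). 1 \<le> i \<and> i < j \<and> j \<le> n + 1}"
    using part_bound length_le by (fastforce simp: partition_graph_def)
  show "0 < a i" if "i \<in> {1..n}" for i using netflow that by blast
  show "{1..n} \<subseteq> fst ` partition_graph lam n"
    by (force simp: partition_graph_def)
qed

interpretation positive_flow n "partition_graph lam n" a
  by (rule positive_flow_partition_graph)

text \<open>The edge to \<open>n + 1\<close> extends the interval of the other targets by one. For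
  \<open>i \<le> length lam\<close> the resulting \<open>ith_part lam i + 1\<close> elements play
  the role of the vertices of the corresponding simplex.\<close>

lemma out_neighbours:
  assumes "i \<in> {1..n}"
  shows "{j. (i, j) \<in> partition_graph lam n}
    = {n + 1 - (if i \<le> length lam then ith_part lam i else 0)..n + 1}"
  using assms by (auto simp: partition_graph_def)

lemma out_degree:
  assumes "i \<in> {1..n}"
  shows "card {j. (i, j) \<in> partition_graph lam n}
    = Suc (if i \<le> length lam then ith_part lam i else 0)"
  using assms part_bound[of i] by (auto simp: out_neighbours)

lemma card_partition_graph: "card (partition_graph lam n) = n + sum_list lam"
proof -
  have "partition_graph lam n = (SIGMA i:{1..n}. {j. (i, j) \<in> partition_graph lam n})"
    using edge_source by auto
  then have "card (partition_graph lam n)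
      = card (SIGMA i:{1..n}. {j. (i, j) \<in> partition_graph lam n})" by (rule arg_cong)
  also have "\<dots> = (\<Sum>i = 1..n. Suc (if i \<le> length lam then ith_part lam i else 0))"
    using finite_out out_degree by simp
  also have "\<dots> = n + (\<Sum>i = 1..n. if i \<le> length lam then ith_part lam i else 0)"
    by (simp add: sum_Suc)
  also have "(\<Sum>i = 1..n. if i \<le> length lam then ith_part lam i else 0)
      = (\<Sum>i = 1..length lam. ith_part lam i)"
    using length_le by (intro sum.mono_neutral_cong_right) auto
  finally show ?thesis by (simp add: sum_list_eq_sum_ith_part)
qed

text \<open>
  The nodes beyond \<open>length lam\<close> have a single outgoing edge, which every support contains, so a
  support is determined by its edges leaving the nodes \<open>1, \<dots>, length lam\<close>.
\<close>

lemma face_poset_isomorphic_simplex_product: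
  "face_poset_isomorphic P (simplex_product lam)"
proof (rule face_poset_isomorphicI[OF standard_form_axioms standard_form_simplex_product])
  \<comment> \<open>\<open>m i\<close> is the smallest out-neighbour of \<open>i\<close>, so
    subtracting it turns the out-neighbours into the vertices \<open>0, ..., ith_part lam i\<close>
    of the factor.\<close>
  define m where "m i = n + 1 - ith_part lam i" for i
  define \<sigma> where "\<sigma> S = {(i, j). i \<in> {1..length lam} \<and> (i, j + m i) \<in> S}" for S :: "(nat \<times> nat) set"
  have forced: "(i, n + 1) \<in> S" if S: "S \<in> supports" and i: "i \<in> {1..n}" and gt: "length lam < i" for S i
  proof -
    obtain j where "(i, j) \<in> S" "(i, j) \<in> partition_graph lam n"
      using S i by (fastforce simp: supports_def)
    moreover have "j = n + 1"
      using calculation(2) out_neighbours[OF i] gt by auto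
    ultimately show ?thesis by simp
  qed
  have low: "m i \<le> j" "j - m i \<le> ith_part lam i"
    if "(i, j) \<in> partition_graph lam n" "i \<in> {1..length lam}" for i j
  proof -
    have "i \<in> {1..n}" using that length_le by auto
    then have "j \<in> {n + 1 - ith_part lam i..n + 1}"
      using out_neighbours[of i] that by auto
    then show "m i \<le> j" "j - m i \<le> ith_part lam i" by (auto simp: m_def)
  qed
  show "\<sigma> S \<subseteq> \<sigma> T \<longleftrightarrow> S \<subseteq> T"
    if "S \<in> Poly_Mapping.keys ` P" "T \<in> Poly_Mapping.keys ` P" for S T
  proof
    have S: "S \<in> supports" and T: "T \<in> supports" using that by (simp_all add: keys_image_flow)
    assume le: "\<sigma> S \<subseteq> \<sigma> T"
    show "S \<subseteq> T"
    proof clarify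
      fix i j assume ij: "(i, j) \<in> S"
      then have E: "(i, j) \<in> partition_graph lam n" using S by (auto simp: supports_def)
      have i: "i \<in> {1..n}" using E by (rule edge_source)
      show "(i, j) \<in> T"
      proof (cases "i \<le> length lam")
        case True
        then have i': "i \<in> {1..length lam}" using i by simp
        then have "(i, j - m i) \<in> \<sigma> S" using ij low[OF E i'] by (simp add: \<sigma>_def)
        then have "(i, j - m i) \<in> \<sigma> T" using le by blast
        then show ?thesis using low[OF E i'] by (simp add: \<sigma>_def)
      next
        case False
        have "j \<in> {j. (i, j) \<in> partition_graph lam n}" using E by simp
        then have "j = n + 1" using False by (simp add: out_neighbours[OF i])
        then show ?thesis using forced[OF T i] False by simp
      qed
    qed
  qed (auto simp: \<sigma>_def)
  show "\<sigma> ` Poly_Mapping.keys ` P = Poly_Mapping.keys ` simplex_product lam"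
    unfolding keys_image_flow keys_image_simplex_product
  proof (intro equalityI subsetI)
    fix T assume "T \<in> \<sigma> ` supports"
    then obtain S where S: "S \<in> supports" "T = \<sigma> S" by auto
    have "T \<subseteq> product_support lam"
    proof clarify
      fix i j assume "(i, j) \<in> T"
      then have "i \<in> {1..length lam}" "(i, j + m i) \<in> partition_graph lam n"
        using S by (auto simp: \<sigma>_def supports_def)
      with low(2)[of i "j + m i"] show "(i, j) \<in> product_support lam"
        by (simp add: product_support_def)
    qed
    moreover have "i \<in> fst ` T" if i: "i \<in> {1..length lam}" for i
    proof -
      have "i \<in> {1..n}" using i length_le by auto
      then obtain j where ij: "(i, j) \<in> S" "(i, j) \<in> partition_graph lam n"
        using S by (fastforce simp: supports_def)
      then have "(i, j - m i) \<in> T" using S i low[OF ij(2) i] by (simp add: \<sigma>_def)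
      then show ?thesis by force
    qed
    ultimately show "T \<in> {S. S \<subseteq> product_support lam \<and> {1..length lam} \<subseteq> fst ` S}" by auto
  next
    fix T assume "T \<in> {S. S \<subseteq> product_support lam \<and> {1..length lam} \<subseteq> fst ` S}"
    then have T: "T \<subseteq> product_support lam" and cover: "{1..length lam} \<subseteq> fst ` T" by auto
    \<comment> \<open>The preimage under \<open>\<sigma>\<close>: targets are shifted back and the
      forced edges beyond \<open>length lam\<close> restored.\<close>
    define S where "S = (\<lambda>(i, j). (i, j + m i)) ` T \<union> {(i, n + 1) | i. i \<in> {length lam<..n}}"
    have "S \<subseteq> partition_graph lam n"
    proof -
      have "(i, j + m i) \<in> partition_graph lam n" if ij: "(i, j) \<in> T" for i j
      proof -
        have i: "i \<in> {1..length lam}" and j: "j \<le> ith_part lam i"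
          using T ij by (auto simp: product_support_def)
        have "i \<in> {1..n}" using i length_le by auto
        \<comment> \<open>\<open>part_bound\<close> keeps the subtraction in \<open>m i\<close> from
          being truncated, so \<open>m i + ith_part lam i = n + 1\<close>.\<close>
        moreover have "j + m i \<in> {n + 1 - ith_part lam i..n + 1}"
          using j part_bound[OF i] by (auto simp: m_def)
        ultimately have "j + m i \<in> {j. (i, j) \<in> partition_graph lam n}"
          using i by (simp only: out_neighbours if_True atLeastAtMost_iff)
        then show ?thesis by simp
      qed
      moreover have "(i, n + 1) \<in> partition_graph lam n" if "i \<in> {length lam<..n}" for i
        using that by (auto simp: partition_graph_def)
      ultimately show ?thesis by (auto simp: S_def)
    qed
    moreover have "i \<in> fst ` S" if i: "i \<in> {1..n}" for i
    proof (cases "i \<le> length lam")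
      case True
      then have "i \<in> fst ` T" using i cover by auto
      then show ?thesis by (force simp: S_def)
    next
      case False
      then have "(i, n + 1) \<in> S" using i by (simp add: S_def)
      then show ?thesis by force
    qed
    ultimately have "S \<in> supports" by (auto simp: supports_def)
    moreover have "\<sigma> S = T"
      using T by (auto simp: \<sigma>_def S_def product_support_def)
    ultimately show "T \<in> \<sigma> ` supports" by blast
  qed
qed

lemma direction_dim_partition_flow: "direction_dim P = sum_list lam"
  by (simp add: direction_dim_flow card_partition_graph)

lemma h_polynomial_partition_flow:
  "h_polynomial P = (\<Prod>i = 1..length lam. \<Sum>j = 0..ith_part lam i. [:0, 1:] ^ j)"
proof -
  have "h_polynomial P = (\<Prod>i = 1..n.
      \<Sum>j\<le>(if i \<le> length lam then ith_part lam i else 0). [:0, 1:] ^ j)"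
    unfolding h_polynomial_flow
    by (intro prod.cong refl) (simp only: out_degree lessThan_Suc_atMost)
  \<comment> \<open>Each node beyond \<open>length lam\<close> contributes the factor 1, the sum
    over \<open>j \<le> 0\<close>.\<close>
  also have "\<dots> = (\<Prod>i = 1..length lam. \<Sum>j = 0..ith_part lam i. [:0, 1:] ^ j)"
    using length_le by (intro prod.mono_neutral_cong_right) (auto simp: atLeast0AtMost)
  finally show ?thesis .
qed

end

theorem theorem4p7:
  fixes lam :: "nat list" and n :: nat and a :: "nat \<Rightarrow> int"
  assumes "is_partition lam"
    and "\<forall>i\<in>{1..length lam}. int n - int i \<ge> int (ith_part lam i)"
    and "\<forall>i\<in>{1..n}. a i > 0"
  shows "face_poset_isomorphic (flow_polytope n (partition_graph lam n) a) (simplex_product lam) \<and>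
         simple_polytope (flow_polytope n (partition_graph lam n) a) \<and>
         direction_dim (flow_polytope n (partition_graph lam n) a) = sum_list lam \<and>
         h_polynomial (flow_polytope n (partition_graph lam n) a)
           = (\<Prod>i = 1..length lam. \<Sum>j = 0..ith_part lam i. [:0, 1:] ^ j)"
proof (intro conjI)
  interpret positive_flow n "partition_graph lam n" a
    using assms(2,3) by (rule positive_flow_partition_graph)
  show "simple_polytope P" by (rule simple_polytope_flow)
  show "face_poset_isomorphic P (simplex_product lam)"
    using assms(2,3) by (rule face_poset_isomorphic_simplex_product)
  show "direction_dim P = sum_list lam"
    using assms(2,3) by (rule direction_dim_partition_flow)
  show "h_polynomial P = (\<Prod>i = 1..length lam. \<Sum>j = 0..ith_part lam i. [:0, 1:] ^ j)"
    using assms(2,3) by (rule h_polynomial_partition_flow)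
qed

end
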